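(* Let $n\ge1$, let $\mathbf{X}$ be any random vector in $\mathbb{R}^n$, let $\mathsf{snr}>0$, and let $\mathbf{Y}=\sqrt{\mathsf{snr}}\,\mathbf{X}+\mathbf{Z}$ with $\mathbf{Z}\sim\mathcal{N}(\mathbf{0},\mathbf{I})$ in $\mathbb{R}^n$ independent of $\mathbf{X}$. Then $$\frac1n\mathrm{Tr}\left(\mathbb{E}[\mathbf{Cov}^2(\mathbf{X}|\mathbf{Y})]\right)\le\frac{k_n}{\mathsf{snr}^2},$$ where $$k_n= \frac{n(n+2)-n\,\mathrm{mmse}(\mathbf{Z}\mathbf{Z}^{T}|\mathbf{Y})-\mathrm{Tr}\left(\mathbf{J}^2(\mathbf{Y})\right)}{n}\le n+2.$$
   Context: $\mathbf{Cov}(\mathbf{X}|\mathbf{Y})=\mathbb{E}\left[(\mathbf{X}-\mathbb{E}[\mathbf{X}|\mathbf{Y}])(\mathbf{X}-\mathbb{E}[\mathbf{X}|\mathbf{Y}])^{T}\,|\,\mathbf{Y}\right]$ is the conditional covariance matrix and $\mathbf{Cov}^2$ its matrix square. For the random matrix $\mathbf{Z}\mathbf{Z}^T$, $\mathbf{Cov}(\mathbf{Z}\mathbf{Z}^T|\mathbf{Y})=\mathbb{E}[\mathbf{Z}\mathbf{Z}^T(\mathbf{Z}\mathbf{Z}^T)^T|\mathbf{Y}]-\mathbb{E}[\mathbf{Z}\mathbf{Z}^T|\mathbf{Y}]\left(\mathbb{E}[\mathbf{Z}\mathbf{Z}^T|\mathbf{Y}]\right)^T$ and $\mathrm{mmse}(\mathbf{Z}\mathbf{Z}^T|\mathbf{Y})=\frac1n\mathrm{Tr}\left(\mathbb{E}[\mathbf{Cov}(\mathbf{Z}\mathbf{Z}^T|\mathbf{Y})]\right)$.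 $\mathbf{J}(\mathbf{Y})=\mathbb{E}\left[\nabla\log p_{\mathbf{Y}}(\mathbf{Y})\,(\nabla\log p_{\mathbf{Y}}(\mathbf{Y}))^T\right]$ is the Fisher information matrix of $\mathbf{Y}$, where $p_{\mathbf{Y}}$ is the density of $\mathbf{Y}$. *)

theory Defs
  imports "HOL-Probability.Probability"
begin

definition outer_prod :: "real ^ 'n \<Rightarrow> real ^ 'n \<Rightarrow> real ^ 'n ^ 'n"
  where "outer_prod u v = (\<chi> i j. u $ i * v $ j)"

definition std_gaussian_density :: "real ^ 'n \<Rightarrow> real"
  where "std_gaussian_density z = exp (- (norm z)\<^sup>2 / 2) / sqrt (2 * pi) ^ CARD('n)"

definition sigma_gen :: "'a measure \<Rightarrow> ('a \<Rightarrow> real ^ 'n) \<Rightarrow> 'a measure"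
  where "sigma_gen M Y = vimage_algebra (space M) Y borel"

(* The library's real_cond_exp is the difference of the conditional expectations of the
   positive and the negative part, so E[U|Y] has its usual meaning as soon as
   E[ |U_i| | Y ] is finite almost surely; U itself need not be integrable.  For
   Y = sqrt snr X + Z this covers U = X and the products of its centred coordinates
   without any moment assumption on X, since sqrt snr X differs from -Z by a function of Y. *)
definition vec_cond_exp ::
  "'a measure \<Rightarrow> ('a \<Rightarrow> real ^ 'n) \<Rightarrow> ('a \<Rightarrow> real ^ 'm) \<Rightarrow> 'a \<Rightarrow> real ^ 'm"
  where "vec_cond_exp M Y U \<omega> = (\<chi> i. real_cond_exp M (sigma_gen M Y) (\<lambda>\<omega>'. U \<omega>' $ i) \<omega>)"

definition mat_cond_exp ::
  "'a measure \<Rightarrow> ('a \<Rightarrow> real ^ 'n) \<Rightarrow> ('a \<Rightarrow> real ^ 'm ^ 'm) \<Rightarrow> 'a \<Rightarrow> real ^ 'm ^ 'm"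
  where "mat_cond_exp M Y W \<omega> =
    (\<chi> i j. real_cond_exp M (sigma_gen M Y) (\<lambda>\<omega>'. W \<omega>' $ i $ j) \<omega>)"

definition cond_cov ::
  "'a measure \<Rightarrow> ('a \<Rightarrow> real ^ 'n) \<Rightarrow> ('a \<Rightarrow> real ^ 'm) \<Rightarrow> 'a \<Rightarrow> real ^ 'm ^ 'm"
  where "cond_cov M Y U =
    mat_cond_exp M Y (\<lambda>\<omega>. outer_prod (U \<omega> - vec_cond_exp M Y U \<omega>) (U \<omega> - vec_cond_exp M Y U \<omega>))"

definition mat_cond_cov ::
  "'a measure \<Rightarrow> ('a \<Rightarrow> real ^ 'n) \<Rightarrow> ('a \<Rightarrow> real ^ 'm ^ 'm) \<Rightarrow> 'a \<Rightarrow> real ^ 'm ^ 'm"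
  where "mat_cond_cov M Y W \<omega> =
    mat_cond_exp M Y (\<lambda>\<omega>'. W \<omega>' ** transpose (W \<omega>')) \<omega>
      - mat_cond_exp M Y W \<omega> ** transpose (mat_cond_exp M Y W \<omega>)"

definition mat_mmse ::
  "'a measure \<Rightarrow> ('a \<Rightarrow> real ^ 'n) \<Rightarrow> ('a \<Rightarrow> real ^ 'm ^ 'm) \<Rightarrow> real"
  where "mat_mmse M Y W = trace (\<integral>\<omega>. mat_cond_cov M Y W \<omega> \<partial>M) / real CARD('m)"

(* A density is determined only up to null sets, whereas the score needs its pointwise
   gradient; the continuous version is unique whenever it exists. *)
definition cont_density :: "'a measure \<Rightarrow> ('a \<Rightarrow> real ^ 'n) \<Rightarrow> real ^ 'n \<Rightarrow> real"
  where "cont_density M Y =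
    (THE p. (\<forall>y. 0 \<le> p y) \<and> continuous_on UNIV p \<and> distributed M lborel Y (\<lambda>y. ennreal (p y)))"

definition gradient :: "('b::real_inner \<Rightarrow> real) \<Rightarrow> 'b \<Rightarrow> 'b"
  where "gradient f x = (THE D. GDERIV f x :> D)"

definition score :: "'a measure \<Rightarrow> ('a \<Rightarrow> real ^ 'n) \<Rightarrow> real ^ 'n \<Rightarrow> real ^ 'n"
  where "score M Y = gradient (\<lambda>y. ln (cont_density M Y y))"

definition fisher_info :: "'a measure \<Rightarrow> ('a \<Rightarrow> real ^ 'n) \<Rightarrow> real ^ 'n ^ 'n"
  where "fisher_info M Y =
    (\<integral>\<omega>. outer_prod (score M Y (Y \<omega>)) (score M Y (Y \<omega>)) \<partial>M)"

end

theory Submission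
  imports Defs
begin

text \<open>Write \<open>c = sqrt snr\<close> and let \<open>g\<close> and \<open>S\<close> be the conditional means of \<open>Z\<close> and \<open>Z Z\<^sup>T\<close> given \<open>Y\<close>.
Since \<open>c X\<close> differs from \<open>- Z\<close> by a function of \<open>Y\<close>, the conditional covariance of \<open>X\<close> is
\<open>(S - g g\<^sup>T) / c\<^sup>2\<close>, and the trace of the square of the numerator is \<open>tr S\<^sup>2 - 2 g\<^sup>T S g + |g|\<^sup>4\<close>.
Here \<open>E tr S\<^sup>2 = E |Z|\<^sup>4 - n mmse = n (n + 2) - n mmse\<close>. Positivity of the conditional covariance gives
\<open>E (g\<^sup>T S g) \<ge> E |g|\<^sup>4\<close>, so the other two terms contribute at most \<open>- E |g|\<^sup>4\<close>. Finally the score of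
\<open>Y\<close> is \<open>- g\<close> (Tweedie), so \<open>J = E (g g\<^sup>T)\<close> and Jensen's inequality yields
\<open>E |g|\<^sup>4 = E tr ((g g\<^sup>T)\<^sup>2) \<ge> tr J\<^sup>2\<close>.\<close>

section \<open>Gaussian density and moments\<close>

lemma vec_nth_measurable [measurable]:
  "(\<lambda>x :: real ^ 'n. x $ i) \<in> borel_measurable borel"
  by (intro borel_measurable_continuous_onI continuous_intros)

lemma Basis_vec_real: "(Basis :: (real ^ 'n) set) = range (\<lambda>i. axis i 1)"
  by (auto simp: Basis_vec_def)

lemma prod_Basis_vec:
  "(\<Prod>b\<in>Basis. f (b :: real ^ 'n)) = (\<Prod>i\<in>UNIV. f (axis i 1))"
  unfolding Basis_vec_real by (subst prod.reindex) (auto intro!: injI simp: axis_eq_axis)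

lemma std_gaussian_density_prod:
  "std_gaussian_density (z :: real ^ 'n) = (\<Prod>i\<in>UNIV. std_normal_density (z $ i))"
proof -
  have "(norm z)\<^sup>2 = (\<Sum>i\<in>UNIV. (z $ i)\<^sup>2)"
    unfolding power2_norm_eq_inner inner_vec_def by (simp add: power2_eq_square)
  then have "exp (- (norm z)\<^sup>2 / 2) = (\<Prod>i\<in>UNIV. exp (- (z $ i)\<^sup>2 / 2))"
    by (simp add: exp_sum [symmetric] sum_negf sum_divide_distrib)
  then show ?thesis
    by (simp add: std_gaussian_density_def std_normal_density_def prod_dividef)
qed

text \<open>Gaussian expectations of coordinatewise products factor by Fubini. Working with
  nonnegative integrals gives the value first; integrability on the product space is then a
  consequence of its finiteness.\<close>

lemma nn_integral_std_gaussian_density: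
  fixes g :: "'n::finite \<Rightarrow> real \<Rightarrow> real"
  assumes [measurable]: "\<And>i. g i \<in> borel_measurable borel"
    and nonneg: "\<And>i t. 0 \<le> g i t"
    and int: "\<And>i. has_bochner_integral lborel (\<lambda>t. std_normal_density t * g i t) (m i)"
  shows "(\<integral>\<^sup>+z. ennreal (std_gaussian_density z * (\<Prod>i\<in>UNIV. g i (z $ i))) \<partial>lborel)
    = ennreal (\<Prod>i\<in>UNIV. m i)"
proof -
  \<comment> \<open>\<open>nn_integral_lborel_prod\<close> takes one factor for each basis vector,
    so \<open>THE\<close> recovers the coordinate index \<open>i\<close> from
    \<open>axis i 1\<close>.\<close>
  define G where "G b t = ennreal (std_normal_density t * g (THE i. b = axis i 1) t)"
    for b :: "real ^ 'n" and t
  have G: "G (axis i 1) t = ennreal (std_normal_density t * g i t)" for i t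
    by (simp add: G_def axis_eq_axis)
  have [measurable]: "G b \<in> borel_measurable borel" for b
    unfolding G_def by measurable
  have m: "0 \<le> m i" for i
    using has_bochner_integral_integral_eq [OF int [of i]] nonneg
    by (metis (mono_tags, lifting) integral_nonneg_AE AE_I2 mult_nonneg_nonneg normal_density_nonneg)
  have "(\<integral>\<^sup>+z. ennreal (std_gaussian_density z * (\<Prod>i\<in>UNIV. g i (z $ i))) \<partial>lborel)
      = (\<integral>\<^sup>+z. (\<Prod>b\<in>Basis. G b (z \<bullet> b)) \<partial>lborel)"
    by (intro nn_integral_cong)
      (simp add: prod_Basis_vec G inner_axis std_gaussian_density_prod nonneg prod_ennreal
        flip: prod.distrib)
  also have "\<dots> = (\<Prod>b\<in>Basis. \<integral>\<^sup>+t. G b t \<partial>lborel)"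
    by (rule nn_integral_lborel_prod) simp_all
  also have "\<dots> = (\<Prod>i\<in>UNIV. ennreal (m i))"
    unfolding prod_Basis_vec G
    by (intro prod.cong refl) (rule nn_integral_eq_integral [THEN trans],
        use int nonneg in \<open>auto simp: has_bochner_integral_iff\<close>)
  finally show ?thesis
    by (simp add: prod_ennreal m)
qed

lemma std_gaussian_density_pos: "0 < std_gaussian_density z"
  by (simp add: std_gaussian_density_def)

lemma std_gaussian_density_nonneg [simp]: "0 \<le> std_gaussian_density z"
  by (rule less_imp_le [OF std_gaussian_density_pos])

lemma continuous_on_std_gaussian_density [continuous_intros]:
  "continuous_on S f \<Longrightarrow> continuous_on S (\<lambda>x. std_gaussian_density (f x))"
  unfolding std_gaussian_density_def by (intro continuous_intros) auto

lemma std_gaussian_density_measurable [measurable]: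
  "std_gaussian_density \<in> borel_measurable borel"
  by (intro borel_measurable_continuous_onI continuous_on_std_gaussian_density continuous_on_id)

lemma std_gaussian_fourth_moments:
  fixes Z :: "'a \<Rightarrow> real ^ 'n"
  assumes Z: "distributed M lborel Z (\<lambda>z. ennreal (std_gaussian_density z))"
  shows "has_bochner_integral M (\<lambda>\<omega>. (Z \<omega> $ i)\<^sup>2 * (Z \<omega> $ j)\<^sup>2) (if i = j then 3 else 1)"
proof -
  \<comment> \<open>\<open>d k\<close> is half the exponent of coordinate \<open>k\<close>, so that
    one formula for even moments, \<open>(2 d)! / (2 ^ d * d!)\<close>, covers both cases: it is 1,
    1, 3 for \<open>d\<close> = 0, 1, 2, and the value 2 arises only when
    \<open>i = j\<close>.\<close>
  define d where "d k = (if k = i then 1 else 0 :: nat) + (if k = j then 1 else 0)" for k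
  have [measurable]: "Z \<in> borel_measurable M"
    using distributed_measurable [OF Z] by simp
  have prod: "(\<Prod>k\<in>UNIV. (z $ k) ^ (2 * d k)) = (z $ i)\<^sup>2 * (z $ j)\<^sup>2" for z :: "real ^ 'n"
  proof -
    have "(z $ k) ^ (2 * d k) = (if k = i then (z $ k)\<^sup>2 else 1) * (if k = j then (z $ k)\<^sup>2 else 1)" for k
      by (simp add: d_def power_add power_even_eq power2_eq_square)
    then show ?thesis
      by (simp add: prod.distrib)
  qed
  have moment: "(fact (2 * d k) / (2 ^ d k * fact (d k)) :: real)
      = (if k = i then if i = j then 3 else 1 else 1)" for k
    by (auto simp: d_def fact_numeral)
  have "(\<integral>\<^sup>+\<omega>. ennreal ((Z \<omega> $ i)\<^sup>2 * (Z \<omega> $ j)\<^sup>2) \<partial>M)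
      = (\<integral>\<^sup>+z. ennreal (std_gaussian_density z) * ennreal ((z $ i)\<^sup>2 * (z $ j)\<^sup>2) \<partial>lborel)"
    by (rule distributed_nn_integral [OF Z, symmetric]) simp
  also have "\<dots> = (\<integral>\<^sup>+z. ennreal (std_gaussian_density z * (\<Prod>k\<in>UNIV. (z $ k) ^ (2 * d k))) \<partial>lborel)"
    by (simp only: prod) (simp add: ennreal_mult less_imp_le [OF std_gaussian_density_pos])
  also have "\<dots> = ennreal (\<Prod>k\<in>UNIV. fact (2 * d k) / (2 ^ d k * fact (d k)))"
    by (rule nn_integral_std_gaussian_density) (auto intro: std_normal_moment_even)
  also have "\<dots> = ennreal (if i = j then 3 else 1)"
    by (simp only: moment) simp
  finally show ?thesis
    by (intro has_bochner_integral_nn_integral) auto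
qed

text \<open>Taylor expansion of order two along the segment from \<open>u\<close> to
  \<open>u + h\<close>. The remainder is uniform in \<open>u\<close>, which later permits
  differentiation of a mixture under the integral sign.\<close>

lemma gaussian_taylor_bound:
  fixes u h :: "'b::real_inner"
  shows "\<bar>exp (- (norm (u + h))\<^sup>2 / 2) - exp (- (norm u)\<^sup>2 / 2) + (u \<bullet> h) * exp (- (norm u)\<^sup>2 / 2)\<bar>
    \<le> (norm h)\<^sup>2"
proof -
  define v where "v t = u + t *\<^sub>R h" for t :: real
  define E where "E t = exp (- (v t \<bullet> v t) / 2)" for t
  \<comment> \<open>The derivatives of orders 0, 1 and 2 of \<open>E\<close> along the
    segment.\<close>
  define d where "d m = (if m = 0 then E else if m = 1 then (\<lambda>t. - (v t \<bullet> h) * E t)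
    else (\<lambda>t. ((v t \<bullet> h)\<^sup>2 - h \<bullet> h) * E t))" for m :: nat
  have dv: "((\<lambda>t. v t \<bullet> h) has_real_derivative h \<bullet> h) (at t)" for t
    unfolding v_def by (auto intro!: derivative_eq_intros simp: inner_add_left)
  have vv: "v t \<bullet> v t = u \<bullet> u + 2 * t * (u \<bullet> h) + t\<^sup>2 * (h \<bullet> h)" for t
    by (simp add: v_def inner_add_left inner_add_right inner_commute power2_eq_square algebra_simps)
  have dE: "(E has_real_derivative - (v t \<bullet> h) * E t) (at t)" for t
    unfolding E_def vv
    by (auto intro!: derivative_eq_intros simp: v_def inner_add_left field_simps power2_eq_square)
  have "\<exists>t. 0 < t \<and> t < 1 \<and> E 1 = (\<Sum>m<2. (d m 0 / fact m) * 1 ^ m) + (d 2 t / fact 2) * 1 ^ 2"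
  proof (rule Maclaurin)
    show "\<forall>m t. m < 2 \<and> 0 \<le> t \<and> t \<le> 1 \<longrightarrow> (d m has_real_derivative d (Suc m) t) (at t)"
    proof (intro allI impI)
      fix m :: nat and t :: real
      assume "m < 2 \<and> 0 \<le> t \<and> t \<le> 1"
      then consider "m = 0" | "m = 1" by linarith
      then show "(d m has_real_derivative d (Suc m) t) (at t)"
      proof cases
        case 1
        then show ?thesis using dE by (simp add: d_def)
      next
        case 2
        have "((\<lambda>t. - (v t \<bullet> h) * E t) has_real_derivative ((v t \<bullet> h)\<^sup>2 - h \<bullet> h) * E t) (at t)"
          by (rule derivative_eq_intros dv dE refl)+ (simp add: algebra_simps power2_eq_square)
        then show ?thesis using 2 by (simp add: d_def numeral_2_eq_2)
      qed
    qed
  qed (auto simp: d_def)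
  then obtain t where t: "E 1 = E 0 - (u \<bullet> h) * E 0 + ((v t \<bullet> h)\<^sup>2 - h \<bullet> h) * E t / 2"
    by (auto simp: d_def v_def numeral_2_eq_2)
  \<comment> \<open>The remainder is half the difference of two nonnegative terms. The first is at
    most \<open>2 * |h|^2\<close> by Cauchy-Schwarz and \<open>s * exp (- s) <= 1\<close> for
    \<open>s = |v t|^2 / 2\<close>; the second is at most \<open>|h|^2\<close>. Half of the
    difference is therefore at most \<open>|h|^2\<close> in absolute value.\<close>
  have "(v t \<bullet> h)\<^sup>2 * E t \<le> ((norm (v t))\<^sup>2 * (norm h)\<^sup>2) * E t"
    unfolding power_mult_distrib [symmetric] E_def
    by (intro mult_right_mono) (auto intro!: abs_le_square_iff [THEN iffD1] simp: Cauchy_Schwarz_ineq2)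
  also have "\<dots> = ((v t \<bullet> v t) * E t) * (norm h)\<^sup>2"
    by (simp add: power2_norm_eq_inner)
  also have "\<dots> \<le> 2 * (norm h)\<^sup>2"
  proof (rule mult_right_mono)
    have "(v t \<bullet> v t) / 2 \<le> exp ((v t \<bullet> v t) / 2)"
      using exp_ge_add_one_self [of "(v t \<bullet> v t) / 2"] by linarith
    then show "(v t \<bullet> v t) * E t \<le> 2"
      by (simp add: E_def exp_minus field_simps)
  qed simp
  finally have 1: "(v t \<bullet> h)\<^sup>2 * E t \<le> 2 * (norm h)\<^sup>2" .
  have 2: "0 \<le> (v t \<bullet> h)\<^sup>2 * E t" "0 \<le> (h \<bullet> h) * E t" "(h \<bullet> h) * E t \<le> (norm h)\<^sup>2"
    by (auto simp: E_def power2_norm_eq_inner mult_left_le)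
  have "E 1 = exp (- (norm (u + h))\<^sup>2 / 2)" "E 0 = exp (- (norm u)\<^sup>2 / 2)"
    by (simp_all add: E_def v_def power2_norm_eq_inner)
  with t 1 2 show ?thesis
    by (simp add: left_diff_distrib)
qed

section \<open>Conditional expectations and densities\<close>

context finite_measure_subalgebra
begin

text \<open>Multiplication by an indicator commutes with taking positive and negative parts, so the
  pull-out rule for \<open>nn_cond_exp\<close> applies to each part. This covers functions
  \<open>f\<close> that are not integrable.\<close>

lemma real_cond_exp_indicator:
  assumes [measurable]: "A \<in> sets F" "f \<in> borel_measurable M"
  shows "AE x in M. real_cond_exp M F (\<lambda>x. indicator A x * f x) x = indicator A x * real_cond_exp M F f x"
proof -
  have *: "AE x in M. indicator A x * nn_cond_exp M F (\<lambda>x. ennreal (g x)) x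
      = nn_cond_exp M F (\<lambda>x. ennreal (indicator A x * g x)) x"
    if [measurable]: "g \<in> borel_measurable M" for g
  proof -
    have "(\<lambda>x. ennreal (indicator A x * g x)) = (\<lambda>x. indicator A x * ennreal (g x))"
      by (auto simp: indicator_def)
    then show ?thesis
      using nn_cond_exp_prod [of "indicator A" "\<lambda>x. ennreal (g x)"] by simp
  qed
  have "AE x in M. indicator A x * nn_cond_exp M F (\<lambda>x. ennreal (- f x)) x
      = nn_cond_exp M F (\<lambda>x. ennreal (- (indicator A x * f x))) x"
    using * [of "\<lambda>x. - f x"] by simp
  then show ?thesis
    using * [OF assms(2)]
    unfolding real_cond_exp_def
  proof eventually_elim
    case (elim x)
    then show ?case
      by (auto simp: indicator_def split: if_splits)
  qed
qed

text \<open>Without integrability of \<open>h\<close>: one localizes to the sets where \<open>h\<close> is bounded.\<close>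
lemma real_cond_exp_add_F_meas:
  assumes [measurable]: "h \<in> borel_measurable F" and f: "integrable M f"
  shows "AE x in M. real_cond_exp M F (\<lambda>x. h x + f x) x = h x + real_cond_exp M F f x"
proof -
  note [measurable] = borel_measurable_integrable [OF f]
  have hM [measurable]: "h \<in> borel_measurable M"
    by (rule measurable_from_subalg [OF subalg]) simp
  have sp: "space F = space M"
    using subalg by (simp add: subalgebra_def)
  define A where "A k = {x \<in> space F. \<bar>h x\<bar> \<le> real k}" for k :: nat
  have A [measurable]: "A k \<in> sets F" for k
    unfolding A_def by measurable
  have AM [measurable]: "A k \<in> sets M" for k
    using A subalg by (auto simp: subalgebra_def)
  have "AE x in M. indicator (A k) x * real_cond_exp M F (\<lambda>x. h x + f x) x
      = indicator (A k) x * (h x + real_cond_exp M F f x)" for k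
  proof -
    have ih: "integrable M (\<lambda>x. indicator (A k) x * h x)"
    proof (rule integrable_const_bound [where B = "real k"])
      show "AE x in M. norm (indicator (A k) x * h x) \<le> real k"
        by (auto simp: A_def indicator_def)
    qed simp
    have if': "integrable M (\<lambda>x. indicator (A k) x * f x)"
      using integrable_mult_indicator [OF AM f] by simp
    have "AE x in M. real_cond_exp M F (\<lambda>x. indicator (A k) x * (h x + f x)) x
        = indicator (A k) x * real_cond_exp M F (\<lambda>x. h x + f x) x"
      by (rule real_cond_exp_indicator) simp_all
    moreover have "AE x in M. real_cond_exp M F (\<lambda>x. indicator (A k) x * (h x + f x)) x
        = real_cond_exp M F (\<lambda>x. indicator (A k) x * h x) x + real_cond_exp M F (\<lambda>x. indicator (A k) x * f x) x"
      using real_cond_exp_add [OF ih if'] by (simp add: distrib_left)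
    moreover have "AE x in M. real_cond_exp M F (\<lambda>x. indicator (A k) x * h x) x = indicator (A k) x * h x"
      by (rule real_cond_exp_F_meas [OF ih]) simp
    moreover have "AE x in M. real_cond_exp M F (\<lambda>x. indicator (A k) x * f x) x
        = indicator (A k) x * real_cond_exp M F f x"
      by (rule real_cond_exp_indicator) simp_all
    ultimately show ?thesis
      by eventually_elim (simp add: distrib_left)
  qed
  then have "AE x in M. \<forall>k. indicator (A k) x * real_cond_exp M F (\<lambda>x. h x + f x) x
      = indicator (A k) x * (h x + real_cond_exp M F f x)"
    by (subst AE_all_countable) blast
  moreover have "AE x in M. x \<in> space F"
    by (simp add: sp)
  ultimately show ?thesis
  proof eventually_elim
    case (elim x)
    obtain k where "\<bar>h x\<bar> \<le> real k"
      using real_arch_simple by blast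
    with elim(2) have "x \<in> A k"
      by (simp add: A_def)
    with elim(1) show ?case
      by (metis indicator_simps(1) mult_1)
  qed
qed

end

section \<open>The sigma-algebra generated by a random vector, and its densities\<close>

lemma (in prob_space) sigma_gen_subalgebra:
  assumes [measurable]: "Y \<in> borel_measurable M"
  shows "finite_measure_subalgebra M (sigma_gen M Y)"
proof
  show "subalgebra M (sigma_gen M Y)"
    unfolding subalgebra_def sigma_gen_def
    using sets_image_in_sets [OF refl assms] by simp
qed

lemma measurable_sigma_gen:
  assumes "f \<in> borel_measurable borel"
  shows "(\<lambda>\<omega>. f (Y \<omega>)) \<in> borel_measurable (sigma_gen M Y)"
proof -
  have "Y \<in> measurable (sigma_gen M Y) borel"
    unfolding sigma_gen_def by (rule measurable_vimage_algebra1) simp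
  then show ?thesis
    using assms by (rule measurable_compose)
qed

lemma sets_sigma_gen: "sets (sigma_gen M Y) = {Y -` B \<inter> space M | B. B \<in> sets borel}"
  unfolding sigma_gen_def by (rule sets_vimage_algebra2) simp

text \<open>The set where two continuous functions differ is open, and a nonempty open set is not
  negligible.\<close>

lemma continuous_AE_lborel_eq:
  fixes f g :: "'b::euclidean_space \<Rightarrow> 'c::real_normed_vector"
  assumes "continuous_on UNIV f" "continuous_on UNIV g" "AE x in lborel. f x = g x"
  shows "f = g"
proof (rule ccontr)
  assume "f \<noteq> g"
  have op: "open {x. f x \<noteq> g x}"
    by (rule open_Collect_neq) (use assms in auto)
  from assms(3) obtain N where "{x. f x \<noteq> g x} \<subseteq> N" "N \<in> null_sets lborel"
    by (auto simp: eventually_ae_filter)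
  then have "negligible {x. f x \<noteq> g x}"
    by (meson negligible_iff_null_sets negligible_subset null_sets_completionI)
  with op open_not_negligible \<open>f \<noteq> g\<close> show False
    by fastforce
qed

text \<open>Evaluates the definite description in \<open>cont_density\<close>: two densities of the
  same vector agree almost everywhere, hence everywhere if both are continuous.\<close>

lemma (in prob_space) cont_density_eq:
  assumes nonneg: "\<And>y. 0 \<le> p y" and cont: "continuous_on UNIV p"
    and Y: "distributed M lborel Y (\<lambda>y. ennreal (p y))"
  shows "cont_density M Y = p"
  unfolding cont_density_def
proof (rule the_equality)
  fix p' :: "real ^ 'b \<Rightarrow> real"
  assume p': "(\<forall>y. 0 \<le> p' y) \<and> continuous_on UNIV p' \<and> distributed M lborel Y (\<lambda>y. ennreal (p' y))"
  then have "AE y in lborel. ennreal (p' y) = ennreal (p y)"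
    using distributed_unique Y by blast
  then have "AE y in lborel. p' y = p y"
    by eventually_elim (use p' nonneg in auto)
  then show "p' = p"
    using continuous_AE_lborel_eq cont p' by blast
qed (use assms in auto)

lemma gradient_eqI:
  assumes "GDERIV f x :> D"
  shows "gradient f x = D"
  unfolding gradient_def
proof (rule the_equality)
  show "GDERIV f x :> D" by fact
  fix D' assume "GDERIV f x :> D'"
  then have "(\<lambda>h. h \<bullet> D') = (\<lambda>h. h \<bullet> D)"
    using assms unfolding gderiv_def by (rule has_derivative_unique)
  then show "D' = D"
    by (metis inner_commute vector_eq_ldot)
qed

text \<open>Bayes' formula. The quotient is a function of \<open>Y\<close>, and it has the right
  integral over each event \<open>Y \<in> B\<close>, because Fubini integrates out \<open>x\<close>
  and the factor \<open>p\<close> cancels against the density of \<open>Y\<close>.\<close>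

lemma (in prob_space) real_cond_exp_joint_density:
  fixes Y :: "'a \<Rightarrow> real ^ 'n"
  assumes D: "sigma_finite_measure D"
    and k [measurable]: "case_prod k \<in> borel_measurable (D \<Otimes>\<^sub>M lborel)"
    and k_nonneg: "\<And>x y. 0 \<le> k x y"
    and joint: "distributed M (D \<Otimes>\<^sub>M lborel) (\<lambda>\<omega>. (X \<omega>, Y \<omega>)) (\<lambda>(x, y). ennreal (k x y))"
    and p_pos: "\<And>y. 0 < p y"
    and Y: "distributed M lborel Y (\<lambda>y. ennreal (p y))"
    and f [measurable]: "case_prod f \<in> borel_measurable (D \<Otimes>\<^sub>M lborel)"
    and int: "integrable M (\<lambda>\<omega>. f (X \<omega>) (Y \<omega>))"
  shows "AE \<omega> in M. real_cond_exp M (sigma_gen M Y) (\<lambda>\<omega>. f (X \<omega>) (Y \<omega>)) \<omega>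
    = (\<integral>x. k x (Y \<omega>) * f x (Y \<omega>) \<partial>D) / p (Y \<omega>)"
proof -
  interpret D: sigma_finite_measure D by fact
  interpret pair_sigma_finite D lborel ..
  have Ym [measurable]: "Y \<in> borel_measurable M"
    using distributed_measurable [OF Y] by simp
  interpret G: finite_measure_subalgebra M "sigma_gen M Y"
    by (rule sigma_gen_subalgebra) simp
  define q where "q y = (\<integral>x. k x y * f x y \<partial>D)" for y
  have [measurable]: "p \<in> borel_measurable borel"
    using distributed_real_measurable [OF _ Y] p_pos by (simp add: less_imp_le)
  have kf: "integrable (D \<Otimes>\<^sub>M lborel) (\<lambda>(x, y). k x y * f x y)"
  proof -
    have "integrable (D \<Otimes>\<^sub>M lborel) (\<lambda>z. case_prod k z * case_prod f z)"
      by (subst distributed_integrable [of M _ "\<lambda>\<omega>. (X \<omega>, Y \<omega>)"])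
        (use joint int k_nonneg in \<open>auto simp: case_prod_unfold\<close>)
    then show ?thesis
      by (simp add: case_prod_unfold)
  qed
  have q: "integrable lborel q"
    unfolding q_def by (rule integrable_snd [OF kf])
  then have [measurable]: "q \<in> borel_measurable borel"
    using borel_measurable_integrable by fastforce
  \<comment> \<open>Cancellation of \<open>p\<close>, with a free factor \<open>g\<close>: the
    constant 1 gives integrability of the quotient, the indicator of \<open>B\<close> gives its set
    integrals.\<close>
  have pq: "p y * (g y * (q y / p y)) = g y * q y" for y and g :: "_ \<Rightarrow> real"
    using p_pos [of y] by simp
  have qp_int: "integrable M (\<lambda>\<omega>. q (Y \<omega>) / p (Y \<omega>))"
    by (subst distributed_integrable [OF Y, symmetric])
      (use q pq [of _ "\<lambda>_. 1"] p_pos in \<open>auto simp: less_imp_le\<close>)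
  have "AE \<omega> in M. real_cond_exp M (sigma_gen M Y) (\<lambda>\<omega>. f (X \<omega>) (Y \<omega>)) \<omega> = q (Y \<omega>) / p (Y \<omega>)"
  proof (rule G.real_cond_exp_charact [OF _ int qp_int])
    show "(\<lambda>\<omega>. q (Y \<omega>) / p (Y \<omega>)) \<in> borel_measurable (sigma_gen M Y)"
      by (rule measurable_sigma_gen) simp
    fix A assume "A \<in> sets (sigma_gen M Y)"
    then obtain B where A: "A = Y -` B \<inter> space M" and B [measurable]: "B \<in> sets borel"
      by (auto simp: sets_sigma_gen)
    have "(\<integral>\<omega>\<in>A. f (X \<omega>) (Y \<omega>) \<partial>M) = (\<integral>\<omega>. (\<lambda>(x, y). indicator B y * f x y) (X \<omega>, Y \<omega>) \<partial>M)"
      unfolding set_lebesgue_integral_def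
      by (intro Bochner_Integration.integral_cong) (auto simp: A indicator_def)
    also have "\<dots> = (\<integral>z. case_prod k z * (\<lambda>(x, y). indicator B y * f x y) z \<partial>(D \<Otimes>\<^sub>M lborel))"
      by (rule distributed_integral [symmetric]) (use joint k_nonneg in \<open>auto simp: case_prod_unfold\<close>)
    also have "\<dots> = (\<integral>(x, y). indicator B y * (k x y * f x y) \<partial>(D \<Otimes>\<^sub>M lborel))"
      by (simp add: case_prod_unfold mult.left_commute)
    also have "\<dots> = (\<integral>y. \<integral>x. indicator B y * (k x y * f x y) \<partial>D \<partial>lborel)"
    proof (rule integral_snd [symmetric])
      have "integrable (D \<Otimes>\<^sub>M lborel) (\<lambda>z. indicator (space D \<times> B) z * (case_prod k z * case_prod f z))"
        using integrable_mult_indicator [OF _ kf, of "space D \<times> B"]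
        by (simp add: case_prod_unfold)
      then show "integrable (D \<Otimes>\<^sub>M lborel) (\<lambda>(x, y). indicator B y * (k x y * f x y))"
        by (rule Bochner_Integration.integrable_cong [THEN iffD1, rotated -1])
          (auto simp: space_pair_measure indicator_def)
    qed
    also have "\<dots> = (\<integral>y. p y * (indicator B y * (q y / p y)) \<partial>lborel)"
      unfolding pq by (simp add: q_def)
    also have "\<dots> = (\<integral>\<omega>. indicator B (Y \<omega>) * (q (Y \<omega>) / p (Y \<omega>)) \<partial>M)"
      by (rule distributed_integral [OF Y]) (use p_pos in \<open>auto simp: less_imp_le\<close>)
    also have "\<dots> = (\<integral>\<omega>\<in>A. q (Y \<omega>) / p (Y \<omega>) \<partial>M)"
      unfolding set_lebesgue_integral_def
      by (intro Bochner_Integration.integral_cong) (auto simp: A indicator_def)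
    finally show "(\<integral>\<omega>\<in>A. f (X \<omega>) (Y \<omega>) \<partial>M) = (\<integral>\<omega>\<in>A. q (Y \<omega>) / p (Y \<omega>) \<partial>M)" .
  qed
  then show ?thesis
    by (simp add: q_def)
qed

lemma nn_integral_lborel_shift:
  fixes t :: "'b::euclidean_space"
  assumes [measurable]: "f \<in> borel_measurable borel"
  shows "(\<integral>\<^sup>+y. f (t + y) \<partial>lborel) = (\<integral>\<^sup>+y. f y \<partial>lborel)"
proof -
  have "(lborel :: 'b measure) = distr lborel borel (\<lambda>x. t + x)"
    using lborel_affine [of 1 t] by (simp add: density_1)
  then have "(\<integral>\<^sup>+y. f y \<partial>lborel) = (\<integral>\<^sup>+y. f y \<partial>distr lborel borel (\<lambda>x. t + x))"
    by (rule arg_cong)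
  also have "\<dots> = (\<integral>\<^sup>+y. f (t + y) \<partial>lborel)"
    by (subst nn_integral_distr) simp_all
  finally show ?thesis by simp
qed

text \<open>The reference measure in the first coordinate is the law of \<open>X\<close> itself,
  since \<open>X\<close> may have no Lebesgue density. Independence turns the joint law into an
  iterated integral, and translation invariance of Lebesgue measure is applied for each fixed
  \<open>x\<close>.\<close>

lemma (in prob_space) distributed_scaleR_add:
  fixes X Z :: "'a \<Rightarrow> 'b::euclidean_space"
  assumes Z: "distributed M lborel Z (\<lambda>z. ennreal (\<phi> z))"
    and [measurable]: "\<phi> \<in> borel_measurable borel"
    and indep: "indep_var borel X borel Z"
  shows "distributed M (distr M borel X \<Otimes>\<^sub>M lborel) (\<lambda>\<omega>. (X \<omega>, c *\<^sub>R X \<omega> + Z \<omega>))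
    (\<lambda>(x, y). ennreal (\<phi> (y - c *\<^sub>R x)))"
proof -
  let ?D = "distr M borel X"
  have X [measurable]: "X \<in> borel_measurable M" and Zm [measurable]: "Z \<in> borel_measurable M"
    using indep by (auto simp: indep_var_distribution_eq)
  have eq: "distr M borel X \<Otimes>\<^sub>M distr M borel Z = distr M (borel \<Otimes>\<^sub>M borel) (\<lambda>\<omega>. (X \<omega>, Z \<omega>))"
    using indep by (auto simp: indep_var_distribution_eq)
  interpret D: prob_space ?D by (rule prob_space_distr) simp
  interpret E: prob_space "distr M borel Z" by (rule prob_space_distr) simp
  interpret pair_sigma_finite ?D lborel ..
  have distrZ: "distr M borel Z = density lborel (\<lambda>z. ennreal (\<phi> z))"
    using distributed_distr_eq_density [OF Z] by (metis distr_cong sets_lborel)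
  have "distr M (?D \<Otimes>\<^sub>M lborel) (\<lambda>\<omega>. (X \<omega>, c *\<^sub>R X \<omega> + Z \<omega>))
      = density (?D \<Otimes>\<^sub>M lborel) (\<lambda>(x, y). ennreal (\<phi> (y - c *\<^sub>R x)))" (is "?L = ?R")
  proof (rule measure_eqI)
    show "sets ?L = sets ?R" by simp
    fix A assume "A \<in> sets ?L"
    then have A [measurable]: "A \<in> sets (borel \<Otimes>\<^sub>M borel)"
      by (simp cong: sets_pair_measure_cong)
    have A' [measurable]: "A \<in> sets (?D \<Otimes>\<^sub>M lborel)"
      using A by (simp cong: sets_pair_measure_cong)
    have "emeasure ?L A = (\<integral>\<^sup>+z. indicator A z \<partial>?L)"
      by simp
    also have "\<dots> = (\<integral>\<^sup>+\<omega>. indicator A (X \<omega>, c *\<^sub>R X \<omega> + Z \<omega>) \<partial>M)"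
      by (rule nn_integral_distr) simp_all
    also have "\<dots> = (\<integral>\<^sup>+z. indicator A (fst z, c *\<^sub>R fst z + snd z)
        \<partial>distr M (borel \<Otimes>\<^sub>M borel) (\<lambda>\<omega>. (X \<omega>, Z \<omega>)))"
      by (subst nn_integral_distr) simp_all
    also have "\<dots> = (\<integral>\<^sup>+x. \<integral>\<^sup>+z. indicator A (x, c *\<^sub>R x + z) \<partial>distr M borel Z \<partial>?D)"
      unfolding eq [symmetric] by (subst E.nn_integral_fst [symmetric]) simp_all
    also have "\<dots> = (\<integral>\<^sup>+x. \<integral>\<^sup>+z. ennreal (\<phi> z) * indicator A (x, c *\<^sub>R x + z) \<partial>lborel \<partial>?D)"
      unfolding distrZ by (intro nn_integral_cong nn_integral_density) simp_all
    also have "\<dots> = (\<integral>\<^sup>+x. \<integral>\<^sup>+y. ennreal (\<phi> (y - c *\<^sub>R x)) * indicator A (x, y) \<partial>lborel \<partial>?D)"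
    proof (rule nn_integral_cong)
      fix x
      show "(\<integral>\<^sup>+z. ennreal (\<phi> z) * indicator A (x, c *\<^sub>R x + z) \<partial>lborel)
          = (\<integral>\<^sup>+y. ennreal (\<phi> (y - c *\<^sub>R x)) * indicator A (x, y) \<partial>lborel)"
        using nn_integral_lborel_shift [of "\<lambda>y. ennreal (\<phi> (y - c *\<^sub>R x)) * indicator A (x, y)" "c *\<^sub>R x"]
        by simp
    qed
    also have "\<dots> = emeasure ?R A"
      by (subst emeasure_density)
        (auto simp: case_prod_unfold lborel.nn_integral_fst [symmetric])
    finally show "emeasure ?L A = emeasure ?R A" .
  qed
  then show ?thesis
    by (simp add: distributed_def)
qed

section \<open>Gaussian mixtures\<close>

lemma sqrt_2pi_power_ge_1: "1 \<le> sqrt (2 * pi) ^ k"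
  using pi_gt3 by (intro one_le_power) simp

lemma std_gaussian_density_le: "std_gaussian_density z \<le> exp (- (norm z)\<^sup>2 / 2)"
  using sqrt_2pi_power_ge_1 [where k = "CARD('a)"]
  by (simp add: std_gaussian_density_def field_simps)

lemma std_gaussian_density_le_1: "std_gaussian_density z \<le> 1"
  by (rule order_trans [OF std_gaussian_density_le]) simp

text \<open>With \<open>r\<close> the norm, \<open>2 * r <= r^2 + 1\<close> gives
  \<open>r <= 1 + r^2 / 2 <= exp (r^2 / 2)\<close>. The bound makes the first moment of the kernel
  integrable under every probability measure.\<close>

lemma norm_scaleR_std_gaussian_density_le_1: "norm (std_gaussian_density z *\<^sub>R z) \<le> 1"
proof -
  have "norm (std_gaussian_density z *\<^sub>R z) \<le> exp (- (norm z)\<^sup>2 / 2) * norm z"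
    using std_gaussian_density_le [of z] std_gaussian_density_pos [of z]
    by (simp add: mult_right_mono)
  also have "2 * norm z \<le> (norm z)\<^sup>2 + 1"
    using zero_le_power2 [of "norm z - 1"] by (simp add: power2_diff)
  then have "norm z \<le> exp ((norm z)\<^sup>2 / 2)"
    using exp_ge_add_one_self [of "(norm z)\<^sup>2 / 2"] zero_le_power2 [of "norm z"] by linarith
  then have "exp (- (norm z)\<^sup>2 / 2) * norm z \<le> 1"
    by (simp add: exp_minus field_simps)
  finally show ?thesis .
qed

text \<open>The bound for the unnormalised exponential survives division by the normalising factor,
  which is at least 1.\<close>

lemma std_gaussian_density_taylor_bound:
  "\<bar>std_gaussian_density (u + h) - std_gaussian_density u + (std_gaussian_density u *\<^sub>R u) \<bullet> h\<bar>
    \<le> (norm h)\<^sup>2" (is "\<bar>?L\<bar> \<le> _")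
proof -
  have "?L * sqrt (2 * pi) ^ CARD('a) = exp (- (norm (u + h))\<^sup>2 / 2) - exp (- (norm u)\<^sup>2 / 2)
      + (u \<bullet> h) * exp (- (norm u)\<^sup>2 / 2)"
    by (simp add: std_gaussian_density_def field_simps)
  then have "\<bar>?L\<bar> * sqrt (2 * pi) ^ CARD('a) \<le> (norm h)\<^sup>2"
    using gaussian_taylor_bound [of u h] abs_mult [of ?L "sqrt (2 * pi) ^ CARD('a)"] by simp
  moreover have "\<bar>?L\<bar> * 1 \<le> \<bar>?L\<bar> * sqrt (2 * pi) ^ CARD('a)"
    by (intro mult_left_mono sqrt_2pi_power_ge_1) simp
  ultimately show ?thesis by simp
qed

text \<open>If \<open>D\<close> is the law of \<open>X\<close>, this is the density of
  \<open>c X + Z\<close>.\<close>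

definition gaussian_mixture :: "(real ^ 'n) measure \<Rightarrow> real \<Rightarrow> real ^ 'n \<Rightarrow> real"
  where "gaussian_mixture D c y = (\<integral>x. std_gaussian_density (y - c *\<^sub>R x) \<partial>D)"

text \<open>Minus the gradient of \<open>gaussian_mixture\<close>; divided by the mixture it is the
  conditional mean of the noise given the output value \<open>y\<close>.\<close>

definition gaussian_mixture_moment :: "(real ^ 'n) measure \<Rightarrow> real \<Rightarrow> real ^ 'n \<Rightarrow> real ^ 'n"
  where "gaussian_mixture_moment D c y =
    (\<integral>x. std_gaussian_density (y - c *\<^sub>R x) *\<^sub>R (y - c *\<^sub>R x) \<partial>D)"

context
  fixes D :: "(real ^ 'n) measure" and c :: real
  assumes D: "prob_space D" and sets_D [measurable_cong]: "sets D = sets borel"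
begin

interpretation D: prob_space D by (rule D)

lemma integrable_gaussian_kernel: "integrable D (\<lambda>x. std_gaussian_density (y - c *\<^sub>R x))"
proof (rule D.integrable_const_bound [where B = 1])
  show "AE x in D. norm (std_gaussian_density (y - c *\<^sub>R x)) \<le> 1"
    by (simp add: std_gaussian_density_le_1)
qed simp

lemma integrable_gaussian_kernel_moment:
  "integrable D (\<lambda>x. std_gaussian_density (y - c *\<^sub>R x) *\<^sub>R (y - c *\<^sub>R x))"
proof (rule D.integrable_const_bound [where B = 1])
  show "AE x in D. norm (std_gaussian_density (y - c *\<^sub>R x) *\<^sub>R (y - c *\<^sub>R x)) \<le> 1"
    by (intro AE_I2 norm_scaleR_std_gaussian_density_le_1)
qed simp

lemma gaussian_mixture_pos: "0 < gaussian_mixture D c y"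
proof -
  have "gaussian_mixture D c y \<noteq> 0"
    unfolding gaussian_mixture_def
    by (subst integral_nonneg_eq_0_iff_AE [OF integrable_gaussian_kernel])
      (simp_all add: less_imp_neq [OF std_gaussian_density_pos, symmetric])
  moreover have "0 \<le> gaussian_mixture D c y"
    unfolding gaussian_mixture_def
    by (intro integral_nonneg_AE AE_I2) simp
  ultimately show ?thesis by simp
qed

lemma gaussian_mixture_measurable:
  "gaussian_mixture D c \<in> borel_measurable borel"
  "gaussian_mixture_moment D c \<in> borel_measurable borel"
  unfolding gaussian_mixture_def gaussian_mixture_moment_def
  by (rule D.borel_measurable_lebesgue_integral, measurable)+

lemma GDERIV_gaussian_mixture:
  "GDERIV (gaussian_mixture D c) y :> - gaussian_mixture_moment D c y"
  unfolding gderiv_def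
\<comment> \<open>The Taylor remainder of the kernel is at most \<open>|h|^2\<close> uniformly in
  \<open>x\<close>, and \<open>D\<close> has mass one, so the error quotient is at most
  \<open>|h|\<close>. The bound holds for all \<open>z\<close>; the radius 1 is an arbitrary
  choice.\<close>
proof (rule has_derivativeI_sandwich [where e = 1 and H = "\<lambda>z. norm (z - y)"])
  show "bounded_linear (\<lambda>h. h \<bullet> - gaussian_mixture_moment D c y)"
    by (rule bounded_linear_inner_left)
  show "((\<lambda>z. norm (z - y)) \<longlongrightarrow> 0) (at y)"
    by (auto intro!: tendsto_eq_intros)
  fix z assume "z \<noteq> y"
  define h where "h = z - y"
  define K where "K x = std_gaussian_density (y - c *\<^sub>R x)" for x
  have K: "integrable D K"
    and Kz: "integrable D (\<lambda>x. std_gaussian_density (z - c *\<^sub>R x))"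
    and Km: "integrable D (\<lambda>x. (K x *\<^sub>R (y - c *\<^sub>R x)) \<bullet> h)"
    unfolding K_def
    by (intro integrable_gaussian_kernel integrable_inner_left integrable_gaussian_kernel_moment)+
  have "gaussian_mixture D c z - gaussian_mixture D c y - (z - y) \<bullet> - gaussian_mixture_moment D c y
      = (\<integral>x. std_gaussian_density (z - c *\<^sub>R x) - K x + (K x *\<^sub>R (y - c *\<^sub>R x)) \<bullet> h \<partial>D)"
  proof -
    have "(\<integral>x. (K x *\<^sub>R (y - c *\<^sub>R x)) \<bullet> h \<partial>D) = gaussian_mixture_moment D c y \<bullet> h"
      unfolding gaussian_mixture_moment_def K_def
      by (rule integral_inner_left [OF integrable_gaussian_kernel_moment])
    then show ?thesis
      using K Kz Km
      by (simp add: gaussian_mixture_def h_def inner_commute flip: K_def del: inner_scaleR_left)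
  qed
  also have "norm \<dots> \<le> (\<integral>x. (norm h)\<^sup>2 \<partial>D)"
  proof (rule Bochner_Integration.integral_norm_bound_integral)
    show "integrable D (\<lambda>x. std_gaussian_density (z - c *\<^sub>R x) - K x + (K x *\<^sub>R (y - c *\<^sub>R x)) \<bullet> h)"
      by (intro Bochner_Integration.integrable_add Bochner_Integration.integrable_diff K Kz Km)
    fix x
    have "(y - c *\<^sub>R x) + h = z - c *\<^sub>R x"
      by (simp add: h_def)
    then show "norm (std_gaussian_density (z - c *\<^sub>R x) - K x + (K x *\<^sub>R (y - c *\<^sub>R x)) \<bullet> h) \<le> (norm h)\<^sup>2"
      using std_gaussian_density_taylor_bound [of "y - c *\<^sub>R x" h] by (simp only: K_def real_norm_def)
  qed simp
  finally show "norm (gaussian_mixture D c z - gaussian_mixture D c y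
      - (z - y) \<bullet> - gaussian_mixture_moment D c y) / norm (z - y) \<le> norm (z - y)"
    using \<open>z \<noteq> y\<close> by (simp add: h_def D.prob_space power2_eq_square field_simps)
qed simp

lemma continuous_on_gaussian_mixture: "continuous_on S (gaussian_mixture D c)"
  using GDERIV_gaussian_mixture unfolding gderiv_def
  by (intro continuous_at_imp_continuous_on ballI) (rule has_derivative_continuous)

lemma gradient_ln_gaussian_mixture:
  "gradient (\<lambda>y. ln (gaussian_mixture D c y)) y
    = - (gaussian_mixture_moment D c y /\<^sub>R gaussian_mixture D c y)"
proof (rule gradient_eqI)
  have "GDERIV (\<lambda>y. ln (gaussian_mixture D c y)) y
      :> inverse (gaussian_mixture D c y) *\<^sub>R (- gaussian_mixture_moment D c y)"
    using gaussian_mixture_pos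
    by (intro GDERIV_DERIV_compose GDERIV_gaussian_mixture) (auto intro!: derivative_eq_intros simp: inverse_eq_divide)
  then show "GDERIV (\<lambda>y. ln (gaussian_mixture D c y)) y
      :> - (gaussian_mixture_moment D c y /\<^sub>R gaussian_mixture D c y)"
    by simp
qed

end

section \<open>Square integrable functions and matrix-valued integrals\<close>

text \<open>A finite combination of fixed matrices with the entries as coefficients, which reduces
  integrability of a matrix-valued map to that of its entries.\<close>

lemma mat_eq_sum_axis:
  "(A :: real ^ 'm ^ 'n) = (\<Sum>i\<in>UNIV. \<Sum>j\<in>UNIV. A $ i $ j *\<^sub>R axis i (axis j 1))"
proof -
  have *: "A $ k $ l * axis k (axis l 1 :: real ^ 'm) $ i $ j
      = (if k = i then if l = j then A $ i $ j else 0 else 0)" for i j k l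
    by (simp add: axis_def)
  show ?thesis
    by (simp add: vec_eq_iff * if_distrib [of "sum _"] cong: if_cong)
      (simp add: sum.If_cases)
qed

lemma integrable_matI:
  fixes A :: "'a \<Rightarrow> real ^ 'm ^ 'n"
  assumes "\<And>i j. integrable M (\<lambda>\<omega>. A \<omega> $ i $ j)"
  shows "integrable M A"
proof -
  have "integrable M (\<lambda>\<omega>. \<Sum>i\<in>UNIV. \<Sum>j\<in>UNIV. A \<omega> $ i $ j *\<^sub>R axis i (axis j 1 :: real ^ 'm))"
    using assms by (intro Bochner_Integration.integrable_sum integrable_scaleR_left) simp
  then show ?thesis
    by (simp only: mat_eq_sum_axis [symmetric])
qed

lemma integral_mat_nth:
  fixes A :: "'a \<Rightarrow> real ^ 'm ^ 'n"
  assumes "integrable M A"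
  shows "(\<integral>\<omega>. A \<omega> \<partial>M) $ i $ j = (\<integral>\<omega>. A \<omega> $ i $ j \<partial>M)"
  using integral_bounded_linear [OF bounded_linear_compose [OF bounded_linear_vec_nth bounded_linear_vec_nth] assms]
  by simp

lemma trace_matrix_mult: "trace (A ** B) = (\<Sum>i\<in>UNIV. \<Sum>j\<in>UNIV. A $ i $ j * B $ j $ i)"
  by (simp add: trace_def matrix_matrix_mult_def)

text \<open>Organises the fourth-moment estimates: all products of two factors among the noise
  coordinates and their conditional means are square integrable, so products of four such factors
  are integrable.\<close>

definition square_integrable :: "'a measure \<Rightarrow> ('a \<Rightarrow> real) \<Rightarrow> bool"
  where "square_integrable M f \<longleftrightarrow> f \<in> borel_measurable M \<and> integrable M (\<lambda>\<omega>. (f \<omega>)\<^sup>2)"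

lemma square_integrable_mult:
  assumes "square_integrable M f" "square_integrable M g"
  shows "integrable M (\<lambda>\<omega>. f \<omega> * g \<omega>)"
proof (rule Bochner_Integration.integrable_bound)
  show "integrable M (\<lambda>\<omega>. (f \<omega>)\<^sup>2 + (g \<omega>)\<^sup>2)"
    using assms by (simp add: square_integrable_def)
  show "(\<lambda>\<omega>. f \<omega> * g \<omega>) \<in> borel_measurable M"
    using assms by (auto simp: square_integrable_def)
  have "\<bar>a * b\<bar> \<le> a\<^sup>2 + b\<^sup>2" for a b :: real
    using sum_squares_bound [of "\<bar>a\<bar>" "\<bar>b\<bar>"] mult_nonneg_nonneg [of "\<bar>a\<bar>" "\<bar>b\<bar>"]
    unfolding abs_mult power2_abs mult.assoc by linarith
  then show "AE \<omega> in M. norm (f \<omega> * g \<omega>) \<le> norm ((f \<omega>)\<^sup>2 + (g \<omega>)\<^sup>2)"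
    by simp
qed

lemma square_integrable_diff:
  assumes "square_integrable M f" "square_integrable M g"
  shows "square_integrable M (\<lambda>\<omega>. f \<omega> - g \<omega>)"
  unfolding square_integrable_def
proof
  show "integrable M (\<lambda>\<omega>. (f \<omega> - g \<omega>)\<^sup>2)"
    using assms square_integrable_mult [OF assms]
    by (simp add: power2_diff square_integrable_def mult.assoc)
qed (use assms in \<open>auto simp: square_integrable_def\<close>)

lemma (in finite_measure) square_integrable_integrable:
  assumes "square_integrable M f"
  shows "integrable M f"
  using square_integrable_mult [OF assms, of "\<lambda>_. 1"] by (simp add: square_integrable_def)

lemma (in prob_space) power2_expectation_le:
  assumes "square_integrable M f"
  shows "(expectation f)\<^sup>2 \<le> expectation (\<lambda>\<omega>. (f \<omega>)\<^sup>2)"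
proof -
  have "variance f = expectation (\<lambda>\<omega>. (f \<omega>)\<^sup>2) - (expectation f)\<^sup>2"
    using square_integrable_integrable [OF assms] assms
    by (intro variance_eq) (simp_all add: square_integrable_def)
  then show ?thesis
    using variance_positive [of f] by linarith
qed

context finite_measure_subalgebra
begin

lemma real_cond_exp_power2_le:
  assumes "square_integrable M f"
  shows "AE x in M. (real_cond_exp M F f x)\<^sup>2 \<le> real_cond_exp M F (\<lambda>x. (f x)\<^sup>2) x"
  using assms square_integrable_integrable [OF assms]
  by (intro real_cond_exp_jensens_inequality(2) [where I = UNIV])
    (auto simp: square_integrable_def convex_power2)

text \<open>Conditioning is a contraction of the space of square integrable functions, by the
  conditional Jensen inequality and the tower property.\<close>

lemma square_integrable_real_cond_exp:
  assumes "square_integrable M f"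
  shows "square_integrable M (real_cond_exp M F f)"
    and "(\<integral>x. (real_cond_exp M F f x)\<^sup>2 \<partial>M) \<le> (\<integral>x. (f x)\<^sup>2 \<partial>M)"
proof -
  have f2: "integrable M (\<lambda>x. (f x)\<^sup>2)"
    using assms by (simp add: square_integrable_def)
  note r = real_cond_exp_int [OF f2]
  have int: "integrable M (\<lambda>x. (real_cond_exp M F f x)\<^sup>2)"
    using r(1) by (rule Bochner_Integration.integrable_bound) (use real_cond_exp_power2_le [OF assms] in auto)
  then show "square_integrable M (real_cond_exp M F f)"
    by (simp add: square_integrable_def)
  show "(\<integral>x. (real_cond_exp M F f x)\<^sup>2 \<partial>M) \<le> (\<integral>x. (f x)\<^sup>2 \<partial>M)"
    using integral_mono_AE [OF int r(1) real_cond_exp_power2_le [OF assms]] r(2) by simp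
qed

end

section \<open>The Gaussian channel\<close>

text \<open>The gain \<open>c\<close> stands for the square root of \<open>snr\<close>. It is an
  arbitrary real here; \<open>c \<noteq> 0\<close> is assumed only where \<open>X\<close> is
  recovered from \<open>Y\<close> and \<open>Z\<close>.\<close>

locale gaussian_channel = prob_space M for M :: "'a measure" +
  fixes X Z Y :: "'a \<Rightarrow> real ^ 'n" and c :: real
  assumes Z: "distributed M lborel Z (\<lambda>z. ennreal (std_gaussian_density z))"
    and indep: "indep_var borel X borel Z"
    and Y: "Y = (\<lambda>\<omega>. c *\<^sub>R X \<omega> + Z \<omega>)"
begin

section \<open>Law and score of the output\<close>

lemma rv [measurable]:
  "X \<in> borel_measurable M" "Z \<in> borel_measurable M" "Y \<in> borel_measurable M"
proof -
  show X [measurable]: "X \<in> borel_measurable M" and Z [measurable]: "Z \<in> borel_measurable M"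
    using indep by (auto simp: indep_var_distribution_eq)
  show "Y \<in> borel_measurable M"
    unfolding Y by measurable
qed

sublocale Y: finite_measure_subalgebra M "sigma_gen M Y"
  by (rule sigma_gen_subalgebra) simp

abbreviation "law \<equiv> distr M borel X"

lemma prob_space_law: "prob_space law"
  by (rule prob_space_distr) simp

lemma distributed_joint:
  "distributed M (law \<Otimes>\<^sub>M lborel) (\<lambda>\<omega>. (X \<omega>, Y \<omega>)) (\<lambda>(x, y). ennreal (std_gaussian_density (y - c *\<^sub>R x)))"
  unfolding Y by (rule distributed_scaleR_add [OF Z _ indep]) simp

lemma distributed_output: "distributed M lborel Y (\<lambda>y. ennreal (gaussian_mixture law c y))"
proof -
  interpret law: prob_space law by (rule prob_space_law)
  have "distr M lborel Y = density lborel (\<lambda>y. \<integral>\<^sup>+x. ennreal (std_gaussian_density (y - c *\<^sub>R x)) \<partial>law)"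
    using distr_marginal2 [OF law.sigma_finite_measure_axioms lborel.sigma_finite_measure_axioms distributed_joint]
    by (simp add: distributed_def)
  also have "(\<lambda>y. \<integral>\<^sup>+x. ennreal (std_gaussian_density (y - c *\<^sub>R x)) \<partial>law) = (\<lambda>y. ennreal (gaussian_mixture law c y))"
    unfolding gaussian_mixture_def
    by (intro ext nn_integral_eq_integral integrable_gaussian_kernel prob_space_law)
      simp_all
  finally show ?thesis
    unfolding distributed_def using gaussian_mixture_measurable [OF prob_space_law, of c] by simp
qed

lemma score_output:
  "score M Y y = - (gaussian_mixture_moment law c y /\<^sub>R gaussian_mixture law c y)"
proof -
  have "cont_density M Y = gaussian_mixture law c"
    by (intro cont_density_eq distributed_output continuous_on_gaussian_mixture less_imp_le
        gaussian_mixture_pos prob_space_law) simp_all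
  then show ?thesis
    using gradient_ln_gaussian_mixture [OF prob_space_law] by (simp add: score_def)
qed

lemma score_measurable: "score M Y \<in> borel_measurable borel"
  using gaussian_mixture_measurable [OF prob_space_law, of c]
  unfolding score_output [abs_def] by simp

text \<open>Tweedie's formula.\<close>
lemma cond_exp_noise:
  assumes int: "integrable M (\<lambda>\<omega>. Z \<omega> $ i)"
  shows "AE \<omega> in M. real_cond_exp M (sigma_gen M Y) (\<lambda>\<omega>. Z \<omega> $ i) \<omega> = - score M Y (Y \<omega>) $ i"
proof -
  interpret law: prob_space law by (rule prob_space_law)
  \<comment> \<open>Written this way the noise is a function of the pair \<open>(X, Y)\<close>, as
    Bayes' formula requires; its numerator is then a coordinate of
    \<open>gaussian_mixture_moment\<close>, and the quotient is minus the score.\<close>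
  have Zi: "Z \<omega> $ i = (Y \<omega> - c *\<^sub>R X \<omega>) $ i" for \<omega>
    by (simp add: Y)
  have "AE \<omega> in M. real_cond_exp M (sigma_gen M Y) (\<lambda>\<omega>. (Y \<omega> - c *\<^sub>R X \<omega>) $ i) \<omega>
    = (\<integral>x. std_gaussian_density (Y \<omega> - c *\<^sub>R x) * (Y \<omega> - c *\<^sub>R x) $ i \<partial>law) / gaussian_mixture law c (Y \<omega>)"
  proof (rule real_cond_exp_joint_density [OF _ _ _ distributed_joint _ distributed_output])
    show "sigma_finite_measure law" ..
    show "integrable M (\<lambda>\<omega>. (Y \<omega> - c *\<^sub>R X \<omega>) $ i)"
      using int by (simp add: Zi)
    show "0 < gaussian_mixture law c y" for y
      by (rule gaussian_mixture_pos [OF prob_space_law]) simp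
  qed measurable
  moreover have "(\<integral>x. std_gaussian_density (y - c *\<^sub>R x) * (y - c *\<^sub>R x) $ i \<partial>law)
      = gaussian_mixture_moment law c y $ i" for y
  proof -
    have "integrable law (\<lambda>x. std_gaussian_density (y - c *\<^sub>R x) *\<^sub>R (y - c *\<^sub>R x))"
      by (rule integrable_gaussian_kernel_moment [OF prob_space_law]) simp
    from integral_bounded_linear [OF bounded_linear_vec_nth this] show ?thesis
      by (simp add: gaussian_mixture_moment_def)
  qed
  ultimately show ?thesis
    unfolding Zi by (simp add: score_output divide_inverse mult.commute)
qed

section \<open>Conditional moments of the noise and their integrability\<close>

abbreviation cond_mean :: "'n \<Rightarrow> 'a \<Rightarrow> real"
  where "cond_mean i \<equiv> real_cond_exp M (sigma_gen M Y) (\<lambda>\<omega>. Z \<omega> $ i)"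

abbreviation cond_moment :: "'n \<Rightarrow> 'n \<Rightarrow> 'a \<Rightarrow> real"
  where "cond_moment i j \<equiv> real_cond_exp M (sigma_gen M Y) (\<lambda>\<omega>. Z \<omega> $ i * Z \<omega> $ j)"

abbreviation noise_cov :: "'n \<Rightarrow> 'n \<Rightarrow> 'a \<Rightarrow> real"
  where "noise_cov i j \<omega> \<equiv> cond_moment i j \<omega> - cond_mean i \<omega> * cond_mean j \<omega>"

lemma square_integrable_ZZ: "square_integrable M (\<lambda>\<omega>. Z \<omega> $ i * Z \<omega> $ j)"
  using std_gaussian_fourth_moments [OF Z, of i j]
  by (auto simp: square_integrable_def power_mult_distrib has_bochner_integral_iff)

lemma expectation_ZZ_power2: "expectation (\<lambda>\<omega>. (Z \<omega> $ i * Z \<omega> $ j)\<^sup>2) = (if i = j then 3 else 1)"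
  using std_gaussian_fourth_moments [OF Z, of i j]
  by (simp add: power_mult_distrib has_bochner_integral_iff)

lemma square_integrable_Z: "square_integrable M (\<lambda>\<omega>. Z \<omega> $ i)"
  using square_integrable_integrable [OF square_integrable_ZZ [of i i]]
  by (simp add: square_integrable_def power2_eq_square)

lemma integrable_Z: "integrable M (\<lambda>\<omega>. Z \<omega> $ i)"
  by (rule square_integrable_integrable [OF square_integrable_Z])

text \<open>The conditional Jensen inequality bounds the squared conditional mean by
  \<open>cond_moment i i\<close>, which is square integrable because \<open>Z\<close> has fourth
  moments.\<close>

lemma square_integrable_cond_mean_power2: "square_integrable M (\<lambda>\<omega>. (cond_mean i \<omega>)\<^sup>2)"
proof -
  have S: "square_integrable M (cond_moment i i)"
    by (rule Y.square_integrable_real_cond_exp [OF square_integrable_ZZ])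
  have "AE \<omega> in M. (cond_mean i \<omega>)\<^sup>2 \<le> cond_moment i i \<omega>"
    using Y.real_cond_exp_power2_le [OF square_integrable_Z [of i]] by (simp add: power2_eq_square)
  then have "AE \<omega> in M. norm (((cond_mean i \<omega>)\<^sup>2)\<^sup>2) \<le> norm ((cond_moment i i \<omega>)\<^sup>2)"
  proof eventually_elim
    case (elim \<omega>)
    show ?case
      unfolding real_norm_def abs_power2 by (rule power_mono [OF elim]) simp
  qed
  with S have "integrable M (\<lambda>\<omega>. ((cond_mean i \<omega>)\<^sup>2)\<^sup>2)"
    by - (rule Bochner_Integration.integrable_bound [where f = "\<lambda>\<omega>. (cond_moment i i \<omega>)\<^sup>2"], simp_all add: square_integrable_def)
  then show ?thesis
    by (simp add: square_integrable_def)
qed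

text \<open>The square of the product is a product of two squares, each of them square integrable;
  the same splitting serves for a conditional mean times a coordinate of \<open>Z\<close>.\<close>

lemma square_integrable_mean_mean: "square_integrable M (\<lambda>\<omega>. cond_mean i \<omega> * cond_mean j \<omega>)"
  using square_integrable_mult [OF square_integrable_cond_mean_power2 square_integrable_cond_mean_power2, of i j]
  by (simp add: square_integrable_def power_mult_distrib)

lemma square_integrable_mean_Z: "square_integrable M (\<lambda>\<omega>. cond_mean i \<omega> * Z \<omega> $ j)"
  using square_integrable_mult [OF square_integrable_cond_mean_power2 square_integrable_ZZ, of i j j]
  by (simp add: square_integrable_def power2_eq_square mult_ac)

lemma square_integrable_cond_moment: "square_integrable M (cond_moment i j)"
  by (rule Y.square_integrable_real_cond_exp [OF square_integrable_ZZ])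

lemma square_integrable_noise_cov: "square_integrable M (noise_cov i j)"
  by (intro square_integrable_diff square_integrable_cond_moment square_integrable_mean_mean)

section \<open>Conditional covariance of the input in terms of the noise\<close>

lemma cond_exp_centred_product:
  "AE \<omega> in M. real_cond_exp M (sigma_gen M Y)
      (\<lambda>\<omega>. (cond_mean i \<omega> - Z \<omega> $ i) * (cond_mean j \<omega> - Z \<omega> $ j)) \<omega> = noise_cov i j \<omega>"
proof -
  let ?E = "real_cond_exp M (sigma_gen M Y)"
  note int = square_integrable_integrable [OF square_integrable_mean_mean [of i j]]
    square_integrable_integrable [OF square_integrable_mean_Z [of i j]]
    square_integrable_integrable [OF square_integrable_mean_Z [of j i]]
    square_integrable_integrable [OF square_integrable_ZZ [of i j]]
  have eq: "(\<lambda>\<omega>. (cond_mean i \<omega> - Z \<omega> $ i) * (cond_mean j \<omega> - Z \<omega> $ j))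
      = (\<lambda>\<omega>. (cond_mean i \<omega> * cond_mean j \<omega> - cond_mean i \<omega> * Z \<omega> $ j)
        - (cond_mean j \<omega> * Z \<omega> $ i - Z \<omega> $ i * Z \<omega> $ j))"
    by (auto simp: algebra_simps)
  have "AE \<omega> in M. ?E (\<lambda>\<omega>. (cond_mean i \<omega> * cond_mean j \<omega> - cond_mean i \<omega> * Z \<omega> $ j)
        - (cond_mean j \<omega> * Z \<omega> $ i - Z \<omega> $ i * Z \<omega> $ j)) \<omega>
      = ?E (\<lambda>\<omega>. cond_mean i \<omega> * cond_mean j \<omega> - cond_mean i \<omega> * Z \<omega> $ j) \<omega>
        - ?E (\<lambda>\<omega>. cond_mean j \<omega> * Z \<omega> $ i - Z \<omega> $ i * Z \<omega> $ j) \<omega>"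
    by (rule Y.real_cond_exp_diff) (use int in simp_all)
  moreover have "AE \<omega> in M. ?E (\<lambda>\<omega>. cond_mean i \<omega> * cond_mean j \<omega> - cond_mean i \<omega> * Z \<omega> $ j) \<omega>
      = ?E (\<lambda>\<omega>. cond_mean i \<omega> * cond_mean j \<omega>) \<omega> - ?E (\<lambda>\<omega>. cond_mean i \<omega> * Z \<omega> $ j) \<omega>"
    by (rule Y.real_cond_exp_diff) (use int in simp_all)
  moreover have "AE \<omega> in M. ?E (\<lambda>\<omega>. cond_mean j \<omega> * Z \<omega> $ i - Z \<omega> $ i * Z \<omega> $ j) \<omega>
      = ?E (\<lambda>\<omega>. cond_mean j \<omega> * Z \<omega> $ i) \<omega> - cond_moment i j \<omega>"
    by (rule Y.real_cond_exp_diff) (use int in simp_all)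
  moreover have "AE \<omega> in M. ?E (\<lambda>\<omega>. cond_mean i \<omega> * cond_mean j \<omega>) \<omega> = cond_mean i \<omega> * cond_mean j \<omega>"
    by (rule Y.real_cond_exp_F_meas) (use int in simp_all)
  moreover have "AE \<omega> in M. ?E (\<lambda>\<omega>. cond_mean i \<omega> * Z \<omega> $ j) \<omega> = cond_mean i \<omega> * cond_mean j \<omega>"
    by (rule Y.real_cond_exp_mult) (use int in simp_all)
  moreover have "AE \<omega> in M. ?E (\<lambda>\<omega>. cond_mean j \<omega> * Z \<omega> $ i) \<omega> = cond_mean j \<omega> * cond_mean i \<omega>"
    by (rule Y.real_cond_exp_mult) (use int in simp_all)
  ultimately show ?thesis
    unfolding eq by eventually_elim simp
qed

text \<open>Splits \<open>X\<close> into \<open>Y / c\<close>, which is known given \<open>Y\<close>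
  but may fail to be integrable, and the integrable noise \<open>- Z / c\<close>. Hence the appeal
  to \<open>real_cond_exp_add_F_meas\<close>.\<close>

lemma cond_exp_input:
  assumes "c \<noteq> 0"
  shows "AE \<omega> in M. X \<omega> $ i - vec_cond_exp M Y X \<omega> $ i = (cond_mean i \<omega> - Z \<omega> $ i) / c"
proof -
  let ?E = "real_cond_exp M (sigma_gen M Y)"
  have X: "X \<omega> $ i = Y \<omega> $ i / c + - 1 / c * Z \<omega> $ i" for \<omega>
    using assms by (simp add: Y field_simps)
  have "(\<lambda>\<omega>. Y \<omega> $ i / c) \<in> borel_measurable (sigma_gen M Y)"
    by (rule measurable_sigma_gen) simp
  then have "AE \<omega> in M. ?E (\<lambda>\<omega>. Y \<omega> $ i / c + - 1 / c * Z \<omega> $ i) \<omega>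
      = Y \<omega> $ i / c + ?E (\<lambda>\<omega>. - 1 / c * Z \<omega> $ i) \<omega>"
    by (rule Y.real_cond_exp_add_F_meas) (intro integrable_mult_right integrable_Z)
  moreover have "AE \<omega> in M. ?E (\<lambda>\<omega>. - 1 / c * Z \<omega> $ i) \<omega> = - 1 / c * cond_mean i \<omega>"
    by (rule Y.real_cond_exp_cmult [OF integrable_Z])
  ultimately show ?thesis
    unfolding vec_cond_exp_def vec_lambda_beta X
    by eventually_elim (simp add: diff_divide_distrib)
qed

lemma cond_cov_input:
  assumes "c \<noteq> 0"
  shows "AE \<omega> in M. cond_cov M Y X \<omega> $ i $ j = noise_cov i j \<omega> / c\<^sup>2"
proof -
  let ?E = "real_cond_exp M (sigma_gen M Y)"
  let ?U = "\<lambda>i \<omega>. X \<omega> $ i - vec_cond_exp M Y X \<omega> $ i"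
  let ?V = "\<lambda>i \<omega>. cond_mean i \<omega> - Z \<omega> $ i"
  have V: "integrable M (\<lambda>\<omega>. ?V i \<omega> * ?V j \<omega>)"
    by (intro square_integrable_mult square_integrable_diff square_integrable_Z
        Y.square_integrable_real_cond_exp)
  have "AE \<omega> in M. ?E (\<lambda>\<omega>. ?U i \<omega> * ?U j \<omega>) \<omega> = ?E (\<lambda>\<omega>. ?V i \<omega> * ?V j \<omega> / c\<^sup>2) \<omega>"
  proof (rule Y.real_cond_exp_cong)
    show "AE \<omega> in M. ?U i \<omega> * ?U j \<omega> = ?V i \<omega> * ?V j \<omega> / c\<^sup>2"
      using cond_exp_input [OF assms, of i] cond_exp_input [OF assms, of j]
      by eventually_elim (simp add: power2_eq_square)
    show "(\<lambda>\<omega>. ?U i \<omega> * ?U j \<omega>) \<in> borel_measurable M"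
      by (simp add: vec_cond_exp_def)
  qed simp
  moreover have "AE \<omega> in M. ?E (\<lambda>\<omega>. ?V i \<omega> * ?V j \<omega> / c\<^sup>2) \<omega> = ?E (\<lambda>\<omega>. ?V i \<omega> * ?V j \<omega>) \<omega> / c\<^sup>2"
    by (rule Y.real_cond_exp_cdiv [OF V])
  moreover note cond_exp_centred_product [of i j]
  ultimately show ?thesis
    unfolding cond_cov_def mat_cond_exp_def outer_prod_def vec_lambda_beta vector_minus_component
    by eventually_elim simp
qed

lemma cond_cov_square_nth:
  assumes "c \<noteq> 0"
  shows "AE \<omega> in M. (cond_cov M Y X \<omega> ** cond_cov M Y X \<omega>) $ i $ j
    = (\<Sum>k\<in>UNIV. noise_cov i k \<omega> * noise_cov k j \<omega>) / c ^ 4"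
proof -
  have "AE \<omega> in M. \<forall>i j. cond_cov M Y X \<omega> $ i $ j = noise_cov i j \<omega> / c\<^sup>2"
    using cond_cov_input [OF assms] by (simp add: AE_all_countable)
  then show ?thesis
    by eventually_elim
      (simp add: matrix_matrix_mult_def sum_divide_distrib power2_eq_square power4_eq_xxxx mult.assoc)
qed

lemma cond_cov_measurable [measurable]:
  "(\<lambda>\<omega>. cond_cov M Y X \<omega> $ i $ j) \<in> borel_measurable M"
  by (simp add: cond_cov_def mat_cond_exp_def)

lemma noise_cov_product_integrable: "integrable M (\<lambda>\<omega>. \<Sum>k\<in>UNIV. noise_cov i k \<omega> * noise_cov k j \<omega>)"
  by (intro Bochner_Integration.integrable_sum square_integrable_mult square_integrable_noise_cov)

text \<open>Almost surely the entries are sums of products of square integrable functions, divided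
  by \<open>c ^ 4\<close>. The expectation of the squared covariance is thus a genuine integral and
  not the default value 0.\<close>

lemma integrable_cond_cov_square:
  assumes "c \<noteq> 0"
  shows "integrable M (\<lambda>\<omega>. cond_cov M Y X \<omega> ** cond_cov M Y X \<omega>)"
proof (rule integrable_matI)
  fix i j
  have "integrable M (\<lambda>\<omega>. (\<Sum>k\<in>UNIV. noise_cov i k \<omega> * noise_cov k j \<omega>) / c ^ 4)"
    by (intro integrable_divide noise_cov_product_integrable)
  moreover have "(\<lambda>\<omega>. (cond_cov M Y X \<omega> ** cond_cov M Y X \<omega>) $ i $ j) \<in> borel_measurable M"
    by (simp add: matrix_matrix_mult_def)
  ultimately show "integrable M (\<lambda>\<omega>. (cond_cov M Y X \<omega> ** cond_cov M Y X \<omega>) $ i $ j)"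
    using AE_symmetric [OF cond_cov_square_nth [OF assms, of i j]]
    by (rule integrable_cong_AE_imp)
qed

lemma trace_cond_cov_square:
  assumes "c \<noteq> 0"
  shows "trace (\<integral>\<omega>. cond_cov M Y X \<omega> ** cond_cov M Y X \<omega> \<partial>M)
    = (\<Sum>i\<in>UNIV. \<Sum>j\<in>UNIV. expectation (\<lambda>\<omega>. (noise_cov i j \<omega>)\<^sup>2)) / c ^ 4"
proof -
  have "expectation (\<lambda>\<omega>. (cond_cov M Y X \<omega> ** cond_cov M Y X \<omega>) $ i $ i)
      = (\<Sum>j\<in>UNIV. expectation (\<lambda>\<omega>. (noise_cov i j \<omega>)\<^sup>2)) / c ^ 4" for i
  proof -
    have "expectation (\<lambda>\<omega>. (cond_cov M Y X \<omega> ** cond_cov M Y X \<omega>) $ i $ i)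
        = expectation (\<lambda>\<omega>. (\<Sum>j\<in>UNIV. noise_cov i j \<omega> * noise_cov j i \<omega>) / c ^ 4)"
      by (rule integral_cong_AE [OF _ _ cond_cov_square_nth [OF assms]])
        (simp_all add: matrix_matrix_mult_def)
    also have "\<dots> = (\<Sum>j\<in>UNIV. expectation (\<lambda>\<omega>. noise_cov i j \<omega> * noise_cov j i \<omega>)) / c ^ 4"
      by (simp add: Bochner_Integration.integral_sum square_integrable_mult square_integrable_noise_cov)
    finally show ?thesis
      \<comment> \<open>Commuting the factors inside the conditional expectations identifies
        \<open>noise_cov j i\<close> with \<open>noise_cov i j\<close>, so the trace of the matrix
        square is a sum of squares.\<close>
      by (simp add: power2_eq_square mult.commute)
  qed
  then show ?thesis
    by (simp add: trace_def integral_mat_nth [OF integrable_cond_cov_square [OF assms]] sum_divide_distrib)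
qed

section \<open>The mmse term and the Fisher information as sums of expectations\<close>

lemma sum_fourth_moments: "(\<Sum>k\<in>UNIV. if i = k then 3 else 1) = real CARD('n) + 2" for i :: 'n
proof -
  have "(\<Sum>k\<in>UNIV. if i = k then 3 else 1 :: real) = (\<Sum>k\<in>UNIV. 1 + (if i = k then 2 else 0))"
    by (intro sum.cong) auto
  then show ?thesis
    by (simp add: sum.distrib)
qed

text \<open>The tower property turns the first term of each diagonal entry into a row sum
  \<open>n + 2\<close> of fourth moments, and the \<open>n\<close> rows add up to
  \<open>n * (n + 2)\<close>. The factor on the left undoes the normalisation in
  \<open>mat_mmse\<close>.\<close>

lemma mmse_ZZ:
  "real CARD('n) * mat_mmse M Y (\<lambda>\<omega>. outer_prod (Z \<omega>) (Z \<omega>))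
    = real CARD('n) * (real CARD('n) + 2) - (\<Sum>i\<in>UNIV. \<Sum>j\<in>UNIV. expectation (\<lambda>\<omega>. (cond_moment i j \<omega>)\<^sup>2))"
proof -
  let ?E = "real_cond_exp M (sigma_gen M Y)"
  let ?C = "mat_cond_cov M Y (\<lambda>\<omega>. outer_prod (Z \<omega>) (Z \<omega>))"
  have C: "?C \<omega> $ i $ j = ?E (\<lambda>\<omega>. \<Sum>k\<in>UNIV. (Z \<omega> $ i * Z \<omega> $ k) * (Z \<omega> $ j * Z \<omega> $ k)) \<omega>
      - (\<Sum>k\<in>UNIV. cond_moment i k \<omega> * cond_moment j k \<omega>)" for i j \<omega>
    by (simp add: mat_cond_cov_def mat_cond_exp_def outer_prod_def matrix_matrix_mult_def transpose_def)
  have 1: "integrable M (\<lambda>\<omega>. \<Sum>k\<in>UNIV. (Z \<omega> $ i * Z \<omega> $ k) * (Z \<omega> $ j * Z \<omega> $ k))" for i j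
    by (intro Bochner_Integration.integrable_sum square_integrable_mult square_integrable_ZZ)
  have 2: "integrable M (\<lambda>\<omega>. \<Sum>k\<in>UNIV. cond_moment i k \<omega> * cond_moment j k \<omega>)" for i j
    by (intro Bochner_Integration.integrable_sum square_integrable_mult square_integrable_cond_moment)
  have int: "integrable M ?C"
    by (rule integrable_matI) (simp only: C, intro Bochner_Integration.integrable_diff Y.real_cond_exp_int 1 2)
  have "expectation (\<lambda>\<omega>. ?C \<omega> $ i $ i) = (\<Sum>k\<in>UNIV. if i = k then 3 else 1)
      - (\<Sum>k\<in>UNIV. expectation (\<lambda>\<omega>. (cond_moment i k \<omega>)\<^sup>2))" for i
  proof -
    have "expectation (\<lambda>\<omega>. ?C \<omega> $ i $ i)
        = expectation (\<lambda>\<omega>. \<Sum>k\<in>UNIV. (Z \<omega> $ i * Z \<omega> $ k) * (Z \<omega> $ i * Z \<omega> $ k))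
          - expectation (\<lambda>\<omega>. \<Sum>k\<in>UNIV. cond_moment i k \<omega> * cond_moment i k \<omega>)"
      \<comment> \<open>The tower property is used from right to left: the plain expectation becomes
        that of the conditional expectation occurring in \<open>?C\<close>.\<close>
      unfolding C Y.real_cond_exp_int(2) [OF 1, symmetric]
      by (intro Bochner_Integration.integral_diff Y.real_cond_exp_int 1 2)
    also have "expectation (\<lambda>\<omega>. \<Sum>k\<in>UNIV. cond_moment i k \<omega> * cond_moment i k \<omega>)
        = (\<Sum>k\<in>UNIV. expectation (\<lambda>\<omega>. cond_moment i k \<omega> * cond_moment i k \<omega>))"
      by (intro Bochner_Integration.integral_sum square_integrable_mult square_integrable_cond_moment)
    also have "expectation (\<lambda>\<omega>. \<Sum>k\<in>UNIV. (Z \<omega> $ i * Z \<omega> $ k) * (Z \<omega> $ i * Z \<omega> $ k))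
        = (\<Sum>k\<in>UNIV. expectation (\<lambda>\<omega>. (Z \<omega> $ i * Z \<omega> $ k) * (Z \<omega> $ i * Z \<omega> $ k)))"
      by (intro Bochner_Integration.integral_sum square_integrable_mult square_integrable_ZZ)
    finally show ?thesis
      by (simp only: power2_eq_square [symmetric] expectation_ZZ_power2)
  qed
  then show ?thesis
    by (simp add: mat_mmse_def trace_def integral_mat_nth [OF int] sum_subtractf sum_fourth_moments)
qed

text \<open>By Tweedie's formula the score at \<open>Y\<close> is minus the conditional mean of the
  noise, and the sign cancels in the outer product. Integrability of the whole matrix comes first,
  to justify integrating entrywise.\<close>

lemma fisher_info_nth:
  "fisher_info M Y $ i $ j = expectation (\<lambda>\<omega>. cond_mean i \<omega> * cond_mean j \<omega>)"
proof -
  have [measurable]: "score M Y \<in> borel_measurable borel"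
    by (rule score_measurable)
  have ae: "AE \<omega> in M. cond_mean i \<omega> * cond_mean j \<omega>
      = outer_prod (score M Y (Y \<omega>)) (score M Y (Y \<omega>)) $ i $ j" for i j
    using cond_exp_noise [OF integrable_Z [of i]] cond_exp_noise [OF integrable_Z [of j]]
    by eventually_elim (simp add: outer_prod_def)
  have meas: "(\<lambda>\<omega>. outer_prod (score M Y (Y \<omega>)) (score M Y (Y \<omega>)) $ i $ j) \<in> borel_measurable M" for i j
    by (simp add: outer_prod_def)
  have "integrable M (\<lambda>\<omega>. outer_prod (score M Y (Y \<omega>)) (score M Y (Y \<omega>)))"
  proof (rule integrable_matI)
    show "integrable M (\<lambda>\<omega>. outer_prod (score M Y (Y \<omega>)) (score M Y (Y \<omega>)) $ i $ j)" for i j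
      using ae [of i j] by (intro integrable_cong_AE_imp [OF square_integrable_integrable [OF square_integrable_mean_mean [of i j]] meas])
        auto
  qed
  then show ?thesis
    unfolding fisher_info_def using integral_cong_AE [OF _ meas ae, of i j]
    by (simp add: integral_mat_nth)
qed

lemma trace_fisher_info_square:
  "trace (fisher_info M Y ** fisher_info M Y)
    = (\<Sum>i\<in>UNIV. \<Sum>j\<in>UNIV. (expectation (\<lambda>\<omega>. cond_mean i \<omega> * cond_mean j \<omega>))\<^sup>2)"
  by (simp add: trace_matrix_mult fisher_info_nth power2_eq_square mult.commute)

section \<open>Comparison of the trace terms\<close>

text \<open>Integrates \<open>(g \<bullet> Z - |g|\<^sup>2)\<^sup>2 \<ge> 0\<close>, where \<open>g\<close> is the conditional mean of \<open>Z\<close>.\<close>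
lemma sum_mean_mean_power2_le:
  "(\<Sum>i\<in>UNIV. \<Sum>j\<in>UNIV. expectation (\<lambda>\<omega>. (cond_mean i \<omega> * cond_mean j \<omega>)\<^sup>2))
    \<le> (\<Sum>i\<in>UNIV. \<Sum>j\<in>UNIV. expectation (\<lambda>\<omega>. cond_mean i \<omega> * cond_mean j \<omega> * cond_moment i j \<omega>))"
proof -
  let ?a = "\<lambda>i \<omega>. cond_mean i \<omega> * Z \<omega> $ i"
  let ?b = "\<lambda>i \<omega>. cond_mean i \<omega> * cond_mean i \<omega>"
  have expand: "expectation (\<lambda>\<omega>. (?a i \<omega> - ?b i \<omega>) * (?a j \<omega> - ?b j \<omega>))
      = expectation (\<lambda>\<omega>. cond_mean i \<omega> * cond_mean j \<omega> * cond_moment i j \<omega>)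
        - expectation (\<lambda>\<omega>. (cond_mean i \<omega> * cond_mean j \<omega>)\<^sup>2)" for i j
  proof -
    \<comment> \<open>All factors but \<open>Z \<omega> $ i\<close> are functions of
      \<open>Y\<close>, so under the expectation this coordinate may be replaced by its conditional
      mean.\<close>
    have swap: "expectation (\<lambda>\<omega>. ?a i \<omega> * ?b j \<omega>) = expectation (\<lambda>\<omega>. (cond_mean i \<omega> * cond_mean j \<omega>)\<^sup>2)" for i j
    proof -
      have "expectation (\<lambda>\<omega>. (cond_mean i \<omega> * ?b j \<omega>) * cond_mean i \<omega>)
          = expectation (\<lambda>\<omega>. (cond_mean i \<omega> * ?b j \<omega>) * Z \<omega> $ i)"
        by (rule Y.real_cond_exp_intg)
          (use square_integrable_mult [OF square_integrable_mean_Z [of i i] square_integrable_mean_mean [of j j]]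
            in \<open>simp_all add: mult_ac\<close>)
      then show ?thesis
        by (simp add: power2_eq_square mult_ac)
    qed
    have "expectation (\<lambda>\<omega>. (cond_mean i \<omega> * cond_mean j \<omega>) * cond_moment i j \<omega>)
        = expectation (\<lambda>\<omega>. (cond_mean i \<omega> * cond_mean j \<omega>) * (Z \<omega> $ i * Z \<omega> $ j))"
      by (rule Y.real_cond_exp_intg)
        (use square_integrable_mult [OF square_integrable_mean_mean [of i j] square_integrable_ZZ [of i j]]
          in simp_all)
    then have aa: "expectation (\<lambda>\<omega>. ?a i \<omega> * ?a j \<omega>)
        = expectation (\<lambda>\<omega>. cond_mean i \<omega> * cond_mean j \<omega> * cond_moment i j \<omega>)"
      by (simp add: mult_ac)
    have bb: "expectation (\<lambda>\<omega>. ?b i \<omega> * ?b j \<omega>) = expectation (\<lambda>\<omega>. (cond_mean i \<omega> * cond_mean j \<omega>)\<^sup>2)"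
      by (simp add: power2_eq_square mult_ac)
    have "(?a i \<omega> - ?b i \<omega>) * (?a j \<omega> - ?b j \<omega>)
        = (?a i \<omega> * ?a j \<omega> - ?a i \<omega> * ?b j \<omega>) - (?a j \<omega> * ?b i \<omega> - ?b i \<omega> * ?b j \<omega>)" for \<omega>
      by (simp add: algebra_simps)
    moreover have "integrable M (\<lambda>\<omega>. ?a i \<omega> * ?a j \<omega>)" "integrable M (\<lambda>\<omega>. ?a i \<omega> * ?b j \<omega>)"
      "integrable M (\<lambda>\<omega>. ?a j \<omega> * ?b i \<omega>)" "integrable M (\<lambda>\<omega>. ?b i \<omega> * ?b j \<omega>)"
      by (intro square_integrable_mult square_integrable_mean_Z square_integrable_mean_mean)+
    ultimately have "expectation (\<lambda>\<omega>. (?a i \<omega> - ?b i \<omega>) * (?a j \<omega> - ?b j \<omega>))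
        = (expectation (\<lambda>\<omega>. ?a i \<omega> * ?a j \<omega>) - expectation (\<lambda>\<omega>. ?a i \<omega> * ?b j \<omega>))
          - (expectation (\<lambda>\<omega>. ?a j \<omega> * ?b i \<omega>) - expectation (\<lambda>\<omega>. ?b i \<omega> * ?b j \<omega>))"
      by (simp only: Bochner_Integration.integral_diff Bochner_Integration.integrable_diff)
    \<comment> \<open>Both mixed terms equal the expectation of
      \<open>(cond_mean i \<omega> * cond_mean j \<omega>)^2\<close>. One cancels the last term, the
      other remains with a minus sign.\<close>
    also have "expectation (\<lambda>\<omega>. ?a j \<omega> * ?b i \<omega>) = expectation (\<lambda>\<omega>. ?b i \<omega> * ?b j \<omega>)"
      unfolding swap bb by (simp add: mult.commute)
    finally show ?thesis
      unfolding aa swap by simp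
  qed
  have "0 \<le> expectation (\<lambda>\<omega>. (\<Sum>i\<in>UNIV. ?a i \<omega> - ?b i \<omega>)\<^sup>2)"
    by simp
  also have "\<dots> = expectation (\<lambda>\<omega>. \<Sum>i\<in>UNIV. \<Sum>j\<in>UNIV. (?a i \<omega> - ?b i \<omega>) * (?a j \<omega> - ?b j \<omega>))"
    by (simp only: power2_eq_square sum_product)
  also have "\<dots> = (\<Sum>i\<in>UNIV. \<Sum>j\<in>UNIV. expectation (\<lambda>\<omega>. (?a i \<omega> - ?b i \<omega>) * (?a j \<omega> - ?b j \<omega>)))"
  proof -
    have "integrable M (\<lambda>\<omega>. (?a i \<omega> - ?b i \<omega>) * (?a j \<omega> - ?b j \<omega>))" for i j
      by (intro square_integrable_mult square_integrable_diff square_integrable_mean_Z square_integrable_mean_mean)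
    then show ?thesis
      by (simp only: Bochner_Integration.integral_sum Bochner_Integration.integrable_sum)
  qed
  finally show ?thesis
    unfolding expand by (simp add: sum_subtractf)
qed

text \<open>Expanding the square produces the cross term with factor -2 and the fourth-order term in
  the conditional means with factor 1. As the cross sum dominates the fourth-order sum, at most
  minus the latter is left, and Jensen's inequality, entry by entry, compares it with the squared
  Fisher information.\<close>

lemma sum_noise_cov_power2_le:
  "(\<Sum>i\<in>UNIV. \<Sum>j\<in>UNIV. expectation (\<lambda>\<omega>. (noise_cov i j \<omega>)\<^sup>2))
    \<le> (\<Sum>i\<in>UNIV. \<Sum>j\<in>UNIV. expectation (\<lambda>\<omega>. (cond_moment i j \<omega>)\<^sup>2))
      - trace (fisher_info M Y ** fisher_info M Y)"
proof -
  have "expectation (\<lambda>\<omega>. (noise_cov i j \<omega>)\<^sup>2)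
      = expectation (\<lambda>\<omega>. (cond_moment i j \<omega>)\<^sup>2)
        - 2 * expectation (\<lambda>\<omega>. cond_mean i \<omega> * cond_mean j \<omega> * cond_moment i j \<omega>)
        + expectation (\<lambda>\<omega>. (cond_mean i \<omega> * cond_mean j \<omega>)\<^sup>2)" for i j
  proof -
    note S = square_integrable_cond_moment [of i j] and G = square_integrable_mean_mean [of i j]
    have "(noise_cov i j \<omega>)\<^sup>2 = (cond_moment i j \<omega>)\<^sup>2
        - 2 * (cond_mean i \<omega> * cond_mean j \<omega> * cond_moment i j \<omega>) + (cond_mean i \<omega> * cond_mean j \<omega>)\<^sup>2" for \<omega>
      by (simp add: power2_diff mult_ac)
    then show ?thesis
      using S G square_integrable_mult [OF G S] by (simp add: square_integrable_def)
  qed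
  then have "(\<Sum>i\<in>UNIV. \<Sum>j\<in>UNIV. expectation (\<lambda>\<omega>. (noise_cov i j \<omega>)\<^sup>2))
      = (\<Sum>i\<in>UNIV. \<Sum>j\<in>UNIV. expectation (\<lambda>\<omega>. (cond_moment i j \<omega>)\<^sup>2))
        - 2 * (\<Sum>i\<in>UNIV. \<Sum>j\<in>UNIV. expectation (\<lambda>\<omega>. cond_mean i \<omega> * cond_mean j \<omega> * cond_moment i j \<omega>))
        + (\<Sum>i\<in>UNIV. \<Sum>j\<in>UNIV. expectation (\<lambda>\<omega>. (cond_mean i \<omega> * cond_mean j \<omega>)\<^sup>2))"
    by (simp only: sum.distrib sum_subtractf sum_distrib_left)
  moreover have "trace (fisher_info M Y ** fisher_info M Y)
      \<le> (\<Sum>i\<in>UNIV. \<Sum>j\<in>UNIV. expectation (\<lambda>\<omega>. (cond_mean i \<omega> * cond_mean j \<omega>)\<^sup>2))"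
    unfolding trace_fisher_info_square
    by (intro sum_mono power2_expectation_le square_integrable_mean_mean)
  ultimately show ?thesis
    using sum_mean_mean_power2_le by linarith
qed

text \<open>Conditioning does not increase second moments, so the sum subtracted in
  \<open>mmse_ZZ\<close> is at most the sum of the full fourth moments,
  \<open>n * (n + 2)\<close>.\<close>

lemma mmse_ZZ_nonneg: "0 \<le> mat_mmse M Y (\<lambda>\<omega>. outer_prod (Z \<omega>) (Z \<omega>))"
proof -
  have "expectation (\<lambda>\<omega>. (cond_moment i j \<omega>)\<^sup>2) \<le> expectation (\<lambda>\<omega>. (Z \<omega> $ i * Z \<omega> $ j)\<^sup>2)" for i j
    by (rule Y.square_integrable_real_cond_exp(2) [OF square_integrable_ZZ])
  then have "(\<Sum>i\<in>UNIV. \<Sum>j\<in>UNIV. expectation (\<lambda>\<omega>. (cond_moment i j \<omega>)\<^sup>2))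
      \<le> (\<Sum>i\<in>UNIV. \<Sum>j\<in>UNIV. expectation (\<lambda>\<omega>. (Z \<omega> $ i * Z \<omega> $ j)\<^sup>2))"
    by (intro sum_mono)
  also have "\<dots> = real CARD('n) * (real CARD('n) + 2)"
    by (simp add: expectation_ZZ_power2 sum_fourth_moments)
  finally have "0 \<le> real CARD('n) * mat_mmse M Y (\<lambda>\<omega>. outer_prod (Z \<omega>) (Z \<omega>))"
    by (simp only: mmse_ZZ)
  then show ?thesis
    by (simp add: zero_le_mult_iff)
qed

end

theorem proposition9:
  fixes M :: "'a measure"
    and X Y Z :: "'a \<Rightarrow> real ^ 'n"
    and snr n k :: real
  assumes "prob_space M"
    and "X \<in> borel_measurable M"
    and "distributed M lborel Z (\<lambda>z. ennreal (std_gaussian_density z))"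
    and "prob_space.indep_var M borel X borel Z"
    and "snr > 0"
    and "Y = (\<lambda>\<omega>. sqrt snr *\<^sub>R X \<omega> + Z \<omega>)"
    and "n = real CARD('n)"
    and "k = (n * (n + 2)
              - n * mat_mmse M Y (\<lambda>\<omega>. outer_prod (Z \<omega>) (Z \<omega>))
              - trace (fisher_info M Y ** fisher_info M Y)) / n"
  shows "integrable M (\<lambda>\<omega>. cond_cov M Y X \<omega> ** cond_cov M Y X \<omega>)
    \<and> trace (\<integral>\<omega>. cond_cov M Y X \<omega> ** cond_cov M Y X \<omega> \<partial>M) / n \<le> k / snr\<^sup>2
    \<and> k \<le> n + 2"
proof -
  define c where "c = sqrt snr"
  interpret prob_space M by fact
  interpret gaussian_channel M X Z Y c
    by unfold_locales (use assms(3,4,6) in \<open>simp_all add: c_def\<close>)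
  \<comment> \<open>The covariance of the input carries the factor \<open>1 / c^2\<close>, so its
    matrix square carries \<open>1 / c ^ 4\<close>, that is \<open>1 / snr^2\<close>.\<close>
  have c: "c \<noteq> 0" and c4: "c ^ 4 = snr\<^sup>2"
    using \<open>snr > 0\<close> power_mult [of c 2 2] by (simp_all add: c_def)
  have n: "0 < n"
    by (simp add: assms(7))
  let ?N = "\<Sum>i\<in>UNIV. \<Sum>j\<in>UNIV. expectation (\<lambda>\<omega>. (noise_cov i j \<omega>)\<^sup>2)"
  \<comment> \<open>\<open>mmse_ZZ\<close> rewrites the sum of the squared conditional moments as
    \<open>n * (n + 2)\<close> minus the mmse term, which makes the right-hand side of
    \<open>sum_noise_cov_power2_le\<close> equal to \<open>n * k\<close>.\<close>
  have "?N \<le> n * k"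
    using sum_noise_cov_power2_le mmse_ZZ n by (simp add: assms(7,8))
  then have "?N / snr\<^sup>2 / n \<le> k / snr\<^sup>2"
    using n \<open>snr > 0\<close> by (simp add: field_simps)
  then have "trace (\<integral>\<omega>. cond_cov M Y X \<omega> ** cond_cov M Y X \<omega> \<partial>M) / n \<le> k / snr\<^sup>2"
    by (simp only: trace_cond_cov_square [OF c] c4)
  \<comment> \<open>Both terms subtracted in \<open>k\<close> are nonnegative; the trace of the
    squared Fisher information is a sum of squares because that matrix is symmetric.\<close>
  moreover have "k \<le> n + 2"
  proof -
    have "0 \<le> trace (fisher_info M Y ** fisher_info M Y)"
      unfolding trace_fisher_info_square by (intro sum_nonneg) simp
    moreover have "0 \<le> n * mat_mmse M Y (\<lambda>\<omega>. outer_prod (Z \<omega>) (Z \<omega>))"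
      using mmse_ZZ_nonneg n by simp
    moreover have "n * k = n * (n + 2) - n * mat_mmse M Y (\<lambda>\<omega>. outer_prod (Z \<omega>) (Z \<omega>))
        - trace (fisher_info M Y ** fisher_info M Y)"
      using n by (simp add: assms(8))
    ultimately have "n * k \<le> n * (n + 2)"
      by linarith
    with n show ?thesis by simp
  qed
  ultimately show ?thesis
    using integrable_cond_cov_square [OF c] by blast
qed

end
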